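(* Every locally connected curve belongs to the class $0\text{-}CR$; that is, if $X$ is a locally connected one-dimensional continuum, then $CR(f)$ is $0$-dimensional for a generic map $f\in C(X,X)$.
   Context: A continuum is a compact connected metric space; a curve is a one-dimensional continuum. For a compact metric space $(X,d)$, $C(X,X)$ is the space of continuous self-maps with the topology of uniform convergence. For $f\in C(X,X)$ and $\epsilon>0$, an $\epsilon$-chain for $f$ from $x$ to $y$ is a finite sequence $x=x_0,x_1,\dots,x_n=y$ ($n\ge 1$) in $X$ with $d(f(x_{i-1}),x_i)<\epsilon$ for $i=1,\dots,n$. A point $x$ is chain recurrent for $f$ if for each $\epsilon>0$ there is an $\epsilon$-chain for $f$ from $x$ to $x$; $CR(f)$ is the set of chain recurrent points of $f$. A property holds for a generic $f\in C(X,X)$ if the set of maps having it is residual, i.e. contains a dense $G_\delta$-subset of $C(X,X)$. The class $0\text{-}CR$ consists of all compact metric spaces $X$ such that $CR(f)$ is $0$-dimensional for a generic $f\in C(X,X)$. *)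

theory Defs
  imports "HOL-Analysis.Analysis"
begin

text \<open>
  Metric spaces are subsets \<open>X\<close> of a type of class \<open>metric_space\<close>, with the restricted metric.
\<close>

definition continuum :: "'a::metric_space set \<Rightarrow> bool"
  where "continuum X \<longleftrightarrow> compact X \<and> connected X \<and> X \<noteq> {}"

text \<open>
  Dimension is the small inductive dimension of the library (\<open>dim_le\<close>), which agrees with the
  covering dimension and the large inductive dimension on separable metric spaces.  The dimension
  is exactly \<open>n\<close>; in particular a \<open>0\<close>-dimensional space is nonempty, since the empty space
  has dimension \<open>-1\<close>.
\<close>

definition has_dimension :: "'a topology \<Rightarrow> int \<Rightarrow> bool"
  where "has_dimension T n \<longleftrightarrow> T dim_le n \<and> \<not> T dim_le (n - 1)"

definition curve :: "'a::metric_space set \<Rightarrow> bool"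
  where "curve X \<longleftrightarrow> continuum X \<and> has_dimension (top_of_set X) 1"

definition eps_chain ::
    "'a::metric_space set \<Rightarrow> ('a \<Rightarrow> 'a) \<Rightarrow> real \<Rightarrow> 'a \<Rightarrow> 'a \<Rightarrow> nat \<Rightarrow> (nat \<Rightarrow> 'a) \<Rightarrow> bool"
  where "eps_chain X f \<epsilon> x y n c \<longleftrightarrow>
    n \<ge> 1 \<and> c 0 = x \<and> c n = y \<and> (\<forall>i\<le>n. c i \<in> X) \<and>
    (\<forall>i\<in>{1..n}. dist (f (c (i - 1))) (c i) < \<epsilon>)"

definition chain_recurrent :: "'a::metric_space set \<Rightarrow> ('a \<Rightarrow> 'a) \<Rightarrow> 'a \<Rightarrow> bool"
  where "chain_recurrent X f x \<longleftrightarrow> x \<in> X \<and> (\<forall>\<epsilon>>0. \<exists>n c. eps_chain X f \<epsilon> x x n c)"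

definition CR :: "'a::metric_space set \<Rightarrow> ('a \<Rightarrow> 'a) \<Rightarrow> 'a set"
  where "CR X f = {x. chain_recurrent X f x}"

text \<open>
  \<open>C(X,X)\<close> with the supremum metric; its elements are functions on the whole type that are
  \<open>undefined\<close> outside \<open>X\<close>, so that each self-map of \<open>X\<close> is represented exactly once.  The bound
  on the image that \<open>cfunspace\<close> asks for is automatic when \<open>X\<close> is compact.
\<close>

definition self_maps :: "'a::metric_space set \<Rightarrow> ('a \<Rightarrow> 'a) metric"
  where "self_maps X = cfunspace (top_of_set X) (submetric euclidean_metric X)"

lemma mtopology_submetric_euclidean:
  "mtopology_of (submetric euclidean_metric X) = top_of_set (X :: 'a::metric_space set)"
  by (simp add: mtopology_of_submetric mtopology_of_euclidean)

lemma mspace_self_maps: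
  assumes "compact X"
  shows "mspace (self_maps X) = {f. continuous_on X f \<and> f \<in> X \<rightarrow> X \<and> f \<in> extensional X}"
proof -
  have "compactin (top_of_set X) (topspace (top_of_set X))"
    using assms by (simp add: compactin_subtopology)
  then show ?thesis
    unfolding self_maps_def
    by (subst compactin_mspace_cfunspace)
       (auto simp: mtopology_submetric_euclidean)
qed

lemma mdist_self_maps:
  assumes "f \<in> mspace (self_maps X)" "g \<in> mspace (self_maps X)" "X \<noteq> {}"
  shows "mdist (self_maps X) f g = (SUP x\<in>X. dist (f x) (g x))"
proof -
  interpret M: Metric_space X dist
    by (metis Met_TC.subspace subset_UNIV)
  show ?thesis
    using assms
    by (auto simp: self_maps_def mdist_cfunspace_eq_mdist_funspace M.fdist_def M.fspace_def)
qed

definition residual_in :: "'a topology \<Rightarrow> 'a set \<Rightarrow> bool"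
  where "residual_in T S \<longleftrightarrow> S \<subseteq> topspace T \<and>
    (\<exists>G. gdelta_in T G \<and> T closure_of G = topspace T \<and> G \<subseteq> S)"

definition generic_self_map :: "'a::metric_space set \<Rightarrow> (('a \<Rightarrow> 'a) \<Rightarrow> bool) \<Rightarrow> bool"
  where "generic_self_map X P \<longleftrightarrow>
    residual_in (mtopology_of (self_maps X)) {f \<in> mspace (self_maps X). P f}"

definition zero_CR :: "'a::metric_space set \<Rightarrow> bool"
  where "zero_CR X \<longleftrightarrow> compact X \<and>
    generic_self_map X (\<lambda>f. has_dimension (top_of_set (CR X f)) 0)"

end

theory Submission
  imports Defs
begin

text \<open>
  The argument is a Baire category argument in the complete space of self-maps of \<open>X\<close>.  For a scale
  \<open>\<delta> > 0\<close>, consider the maps \<open>f\<close> for which some \<open>\<epsilon> > 0\<close> has the property that the points lying on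
  \<open>\<epsilon>\<close>-chains to themselves fall into finitely many pieces of diameter at most \<open>\<delta>\<close> with positive
  distances between them.  These maps form an open set, since a chain for a map close to \<open>f\<close> is a
  chain for \<open>f\<close> with a slightly larger error.  If \<open>f\<close> belongs to these sets for all \<open>\<delta>\<close>, then small clopen
  sets form a base of \<open>CR X f\<close>, so \<open>CR X f\<close> is at most \<open>0\<close>-dimensional; it is nonempty because it contains
  the limit points of orbits.  What remains is density, \<open>chain_recurrence_perturbation\<close>.

  Given \<open>f\<close>, cover \<open>X\<close> by finitely many small open sets with \<open>0\<close>-dimensional frontiers.  The union \<open>B\<close> of
  the frontiers is compact, nowhere dense and, by the sum theorem \<open>small_pieces_Un\<close>, cut into small
  separated pieces; its complement falls into finitely many small open cells.  Change \<open>f\<close> into a map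
  \<open>g\<close> that is constant on each cell except very close to \<open>B\<close>, with values in a finite set \<open>P\<close> disjoint
  from \<open>B\<close>.  Near a piece of \<open>B\<close>, the values on the neighbouring cells are close to each other, and \<open>g\<close>
  interpolates between them along short paths, which exist because \<open>X\<close> is compact and locally
  connected (\<open>compact_locally_connected_uniform_paths\<close>).  A chain for \<open>g\<close> that starts away from \<open>B\<close>
  jumps to a point near \<open>P\<close>, hence is again away from \<open>B\<close>, and stays near \<open>P\<close> forever.  Therefore all chain recurrent
  points of \<open>g\<close> are near \<open>B \<union> P\<close>, and a neighbourhood of this set splits into small separated pieces.
\<close>

section \<open>Short paths in compact locally connected spaces\<close>

text \<open>
  The chain is an infinite sequence that stays at \<open>y\<close> from some index on, so that several chains can
  be cut at one common length.
\<close>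

lemma connected_imp_chain:
  fixes C :: "'a::metric_space set"
  assumes "connected C" "x \<in> C" "y \<in> C" "\<delta> > 0"
  obtains n c where "c 0 = x" "\<And>m. m \<ge> n \<Longrightarrow> c m = y" "\<And>m. c m \<in> C"
    "\<And>m. dist (c m) (c (Suc m)) < \<delta>"
proof -
  define R where "R u v \<longleftrightarrow> u \<in> C \<and> v \<in> C \<and> dist u v < \<delta>" for u v
  have "R\<^sup>*\<^sup>* x y"
  proof (rule connected_equivalence_relation[OF assms(1-3)])
    show "R\<^sup>*\<^sup>* v u" if "R\<^sup>*\<^sup>* u v" for u v
      using that
    proof induction
      case (step v w)
      then have "R w v" by (simp add: R_def dist_commute)
      with step.IH show ?case by (rule converse_rtranclp_into_rtranclp[rotated])
    qed simp
    show "R\<^sup>*\<^sup>* u w" if "R\<^sup>*\<^sup>* u v" "R\<^sup>*\<^sup>* v w" for u v w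
      using that by (rule rtranclp_trans)
    show "\<exists>T. openin (top_of_set C) T \<and> u \<in> T \<and> (\<forall>v\<in>T. R\<^sup>*\<^sup>* u v)" if "u \<in> C" for u
      using that \<open>\<delta> > 0\<close>
      by (intro exI[of _ "C \<inter> ball u \<delta>"]) (auto simp: R_def intro!: r_into_rtranclp)
  qed
  then obtain n where "(R ^^ n) x y"
    by (auto simp: rtranclp_power)
  then obtain f where f: "f 0 = x" "f n = y" "\<And>i. i < n \<Longrightarrow> R (f i) (f (Suc i))"
    by (auto simp: relpowp_fun_conv)
  have inC: "f i \<in> C" if "i \<le> n" for i
    using that f(2) f(3)[of i] assms by (cases "i = n") (auto simp: R_def)
  show ?thesis
  proof
    show "f (min 0 n) = x" by (simp add: f)
    show "f (min m n) = y" if "m \<ge> n" for m using that f by (simp add: min_def)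
    show "f (min m n) \<in> C" for m by (simp add: inC)
    show "dist (f (min m n)) (f (min (Suc m) n)) < \<delta>" for m
      using f(3)[of m] \<open>\<delta> > 0\<close> by (cases "m < n") (auto simp: R_def min_def Suc_le_eq)
  qed
qed

text \<open>
  Local connectedness at the points of a compact set becomes uniform by a Lebesgue number of a
  cover by sets whose traces on \<open>X\<close> lie in small connected sets.
\<close>

lemma compact_locally_connected_uniform:
  fixes X :: "'a::metric_space set"
  assumes "compact X" "locally connected X" "\<epsilon> > 0"
  obtains \<delta> where "\<delta> > 0" "\<delta> \<le> \<epsilon>"
    "\<And>x y. \<lbrakk>x \<in> X; y \<in> X; dist x y < \<delta>\<rbrakk>
      \<Longrightarrow> \<exists>C. connected C \<and> C \<subseteq> X \<and> x \<in> C \<and> y \<in> C \<and> (\<forall>u\<in>C. dist x u < \<epsilon>)"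
proof -
  define good where "good T \<longleftrightarrow> (\<exists>a C. connected C \<and> X \<inter> T \<subseteq> C \<and> C \<subseteq> X \<inter> ball a (\<epsilon>/2))" for T
  have "\<exists>T. open T \<and> good T \<and> a \<in> T" if "a \<in> X" for a
  proof -
    have "openin (top_of_set X) (X \<inter> ball a (\<epsilon>/2))" "a \<in> X \<inter> ball a (\<epsilon>/2)"
      using that \<open>\<epsilon> > 0\<close> by auto
    then obtain u v where "openin (top_of_set X) u" "connected v" "a \<in> u" "u \<subseteq> v"
      "v \<subseteq> X \<inter> ball a (\<epsilon>/2)"
      using \<open>locally connected X\<close> by (metis locallyE)
    then show ?thesis
      unfolding good_def openin_open by blast
  qed
  then have "X \<subseteq> \<Union>{T. open T \<and> good T}" by blast
  from Heine_Borel_lemma[OF \<open>compact X\<close> this]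
  obtain \<delta> where \<delta>: "\<delta> > 0" "\<And>x. x \<in> X \<Longrightarrow> \<exists>T. good T \<and> ball x \<delta> \<subseteq> T"
    by auto metis
  show ?thesis
  proof
    show "min \<delta> \<epsilon> > 0" "min \<delta> \<epsilon> \<le> \<epsilon>" using \<delta> \<open>\<epsilon> > 0\<close> by auto
    fix x y assume xy: "x \<in> X" "y \<in> X" "dist x y < min \<delta> \<epsilon>"
    obtain T a C where "ball x \<delta> \<subseteq> T" "connected C" "X \<inter> T \<subseteq> C" and C: "C \<subseteq> X \<inter> ball a (\<epsilon>/2)"
      using \<delta>(2)[OF xy(1)] unfolding good_def by blast
    moreover have "x \<in> ball x \<delta>" "y \<in> ball x \<delta>" using xy \<delta> by auto
    ultimately have "x \<in> C" "y \<in> C" using xy by blast+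
    moreover have "dist x u < \<epsilon>" if "u \<in> C" for u
    proof -
      have "dist a x < \<epsilon>/2" "dist a u < \<epsilon>/2" using \<open>x \<in> C\<close> that C by auto
      then show ?thesis by metric
    qed
    ultimately show "\<exists>C. connected C \<and> C \<subseteq> X \<and> x \<in> C \<and> y \<in> C \<and> (\<forall>u\<in>C. dist x u < \<epsilon>)"
      using \<open>connected C\<close> C by blast
  qed
qed

text \<open>
  One refinement step of a chain that ends at \<open>y\<close>: each step is a pair of close points, which lies in
  a small connected set and can therefore be replaced by a chain of much smaller steps inside that
  set.  All steps are subdivided into the same number \<open>N\<close> of substeps, so that index \<open>m\<close> of the new
  chain refines index \<open>m div N\<close> of the old one.
\<close>

lemma refine_chain:
  fixes X :: "'a::metric_space set"
  assumes conn: "\<And>x y. \<lbrakk>x \<in> X; y \<in> X; dist x y < \<delta>\<rbrakk>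
      \<Longrightarrow> \<exists>C. connected C \<and> C \<subseteq> X \<and> x \<in> C \<and> y \<in> C \<and> (\<forall>u\<in>C. dist x u < e)"
    and c: "\<And>m. c m \<in> X" "\<And>m. dist (c m) (c (Suc m)) < \<delta>" "\<And>m. m \<ge> M \<Longrightarrow> c m = y"
    and "\<eta> > 0"
  obtains N c' where "N \<ge> 1" "\<And>m. c' m \<in> X" "\<And>m. dist (c' m) (c' (Suc m)) < \<eta>"
    "\<And>m. m \<ge> M * N \<Longrightarrow> c' m = y" "\<And>m. c' (m * N) = c m" "\<And>m. dist (c (m div N)) (c' m) < e"
proof -
  have "\<exists>n b. b 0 = c i \<and> (\<forall>m\<ge>n. b m = c (Suc i)) \<and> (\<forall>m. b m \<in> X \<and> dist (c i) (b m) < e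
      \<and> dist (b m) (b (Suc m)) < \<eta>)" for i
  proof -
    obtain C where C: "connected C" "C \<subseteq> X" "c i \<in> C" "c (Suc i) \<in> C" "\<forall>u\<in>C. dist (c i) u < e"
      using conn[OF c(1) c(1) c(2)] by blast
    show ?thesis
      by (rule connected_imp_chain[OF C(1,3,4) \<open>\<eta> > 0\<close>]) (use C in blast)
  qed
  then obtain n b where b: "\<And>i. b i 0 = c i" "\<And>i m. m \<ge> n i \<Longrightarrow> b i m = c (Suc i)"
    "\<And>i m. b i m \<in> X" "\<And>i m. dist (c i) (b i m) < e" "\<And>i m. dist (b i m) (b i (Suc m)) < \<eta>"
    by metis
  \<comment> \<open>Only the first \<open>M\<close> steps move, so a common length exists; the steps after them are
      filled with the constant chain at \<open>y\<close>.\<close>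
  define N where "N = Suc (\<Sum>i<M. n i)"
  define b' where "b' i = (if i < M then b i else (\<lambda>_. y))" for i
  have N: "n i \<le> N" if "i < M" for i
    unfolding N_def using that member_le_sum[of i "{..<M}" n] by simp
  have "e > 0" "y \<in> X"
    using b(4)[of M 0] c(1)[of M] c(3)[of M] by (auto intro: le_less_trans[OF zero_le_dist])
  then have b': "b' i 0 = c i" "b' i N = c (Suc i)" "b' i m \<in> X" "dist (c i) (b' i m) < e"
    "dist (b' i m) (b' i (Suc m)) < \<eta>" for i m
    using b(1,3,4,5) b(2)[OF N] c(3) \<open>\<eta> > 0\<close> by (auto simp: b'_def)
  define c' where "c' m = b' (m div N) (m mod N)" for m
  have "N \<ge> 1" by (simp add: N_def)
  show ?thesis
  proof
    show "N \<ge> 1" by fact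
    show "c' m \<in> X" "dist (c (m div N)) (c' m) < e" for m by (simp_all add: c'_def b')
    show "c' (m * N) = c m" for m using \<open>N \<ge> 1\<close> by (simp add: c'_def b')
    show "c' m = y" if "m \<ge> M * N" for m
      using that \<open>N \<ge> 1\<close> by (auto simp: c'_def b'_def less_mult_imp_div_less dest: div_le_mono[where k = N])
    show "dist (c' m) (c' (Suc m)) < \<eta>" for m
    proof -
      have "c' (Suc m) = b' (m div N) (Suc (m mod N))"
        unfolding c'_def by (auto simp: div_Suc mod_Suc b')
      then show ?thesis by (simp add: c'_def b')
    qed
  qed
qed

lemma geometric_Cauchy_limit:
  fixes X :: "'a::metric_space set"
  assumes "complete X" "\<And>k. a k \<in> X" "\<And>k. dist (a k) (a (Suc k)) \<le> A / 2^k"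
  obtains l where "l \<in> X" "\<And>k. dist (a k) l \<le> 2 * A / 2^k"
proof -
  have A: "A \<ge> 0" using assms(3)[of 0] order_trans[OF zero_le_dist] by fastforce
  have step: "dist (a k) (a (k + n)) \<le> 2 * A / 2^k - 2 * A / 2^(k + n)" for k n
  proof (induction n)
    case (Suc n)
    have "dist (a k) (a (k + Suc n)) \<le> dist (a k) (a (k + n)) + dist (a (k+n)) (a (Suc (k+n)))"
      by (simp add: dist_triangle)
    also have "\<dots> \<le> 2 * A / 2^k - 2 * A / 2^(k + n) + A / 2^(k+n)"
      using Suc assms(3)[of "k+n"] by linarith
    also have "\<dots> = 2 * A / 2^k - 2 * A / 2^(k + Suc n)" by (simp add: field_simps)
    finally show ?case .
  qed simp
  have le: "dist (a k) (a n) \<le> 2 * A / 2^k" if "k \<le> n" for k n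
    using step[of k "n-k"] that A by (smt (verit) le_add_diff_inverse zero_le_divide_iff zero_le_power)
  have lim: "(\<lambda>k. 2 * A / 2^k) \<longlonglongrightarrow> 0"
    by (rule LIMSEQ_divide_realpow_zero) simp
  have "Cauchy a"
    unfolding Cauchy_altdef2
  proof (intro allI impI)
    fix e :: real assume "e > 0"
    then obtain k where "2 * A / 2^k < e"
      using order_tendstoD(2)[OF lim] by (auto simp: eventually_sequentially)
    then have "\<forall>n\<ge>k. dist (a n) (a k) < e"
      using le[of k] by (auto simp: dist_commute intro: le_less_trans)
    then show "\<exists>N. \<forall>n\<ge>N. dist (a n) (a N) < e" ..
  qed
  then obtain l where l: "l \<in> X" "a \<longlonglongrightarrow> l"
    using assms unfolding complete_def by blast
  have "dist (a k) l \<le> 2 * A / 2^k" for k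
    by (rule LIMSEQ_le_const2[of "\<lambda>n. dist (a k) (a n)"]) (auto intro!: tendsto_intros l le)
  with l that show ?thesis by blast
qed

text \<open>
  The uniform form of the theorem that a compact locally connected metric space is locally path
  connected.  Starting with the two-point chain from \<open>x\<close> to \<open>y\<close>, the chain is refined again and again.
  The \<open>k\<close>-th chain, read as a step function \<open>h k\<close> on \<open>[0, 1]\<close>, has jumps below \<open>D k\<close>, and consecutive
  step functions differ by at most \<open>E k\<close>, a geometric sequence.  The uniform limit of functions whose
  jumps tend to \<open>0\<close> is continuous.
\<close>

lemma compact_locally_connected_uniform_paths:
  fixes X :: "'a::metric_space set"
  assumes "compact X" "locally connected X" "\<epsilon> > 0"
  obtains \<delta> where "\<delta> > 0" "\<delta> \<le> \<epsilon>"
    "\<And>x y. \<lbrakk>x \<in> X; y \<in> X; dist x y < \<delta>\<rbrakk> \<Longrightarrow> \<exists>\<gamma>::real \<Rightarrow> 'a. continuous_on {0..1} \<gamma> \<and>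
       \<gamma> 0 = x \<and> \<gamma> 1 = y \<and> \<gamma> \<in> {0..1} \<rightarrow> X \<and> (\<forall>t\<in>{0..1}. dist x (\<gamma> t) < \<epsilon>)"
proof -
  \<comment> \<open>The total deviation from the first step function is then at most \<open>\<epsilon>/2\<close>.\<close>
  define E where "E k = (\<epsilon>/4) / 2^k" for k :: nat
  have E: "E k > 0" for k using \<open>\<epsilon> > 0\<close> by (simp add: E_def)
  have "\<exists>\<delta>>0. \<delta> \<le> E k \<and> (\<forall>x y. x \<in> X \<longrightarrow> y \<in> X \<longrightarrow> dist x y < \<delta> \<longrightarrow>
    (\<exists>C. connected C \<and> C \<subseteq> X \<and> x \<in> C \<and> y \<in> C \<and> (\<forall>u\<in>C. dist x u < E k)))" for k
    by (rule compact_locally_connected_uniform[OF assms(1,2) E[of k]]) blast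
  then obtain D where D: "\<And>k. D k > 0" "\<And>k. D k \<le> E k"
    "\<And>k x y. \<lbrakk>x \<in> X; y \<in> X; dist x y < D k\<rbrakk>
      \<Longrightarrow> \<exists>C. connected C \<and> C \<subseteq> X \<and> x \<in> C \<and> y \<in> C \<and> (\<forall>u\<in>C. dist x u < E k)"
    by metis
  show ?thesis
  proof
    show "D 0 > 0" by (rule D)
    show "D 0 \<le> \<epsilon>" using D(2)[of 0] \<open>\<epsilon> > 0\<close> by (simp add: E_def)
    fix x y assume xy: "x \<in> X" "y \<in> X" "dist x y < D 0"
    \<comment> \<open>A state \<open>(M, c)\<close> is a chain \<open>c\<close> that reaches \<open>y\<close> after \<open>M\<close> steps.  The first chain is required
        to have one step, so that \<open>h 0\<close> only takes the values \<open>x\<close> and \<open>y\<close>.\<close>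
    define P where "P k s \<longleftrightarrow> fst s \<ge> 1 \<and> (k = 0 \<longrightarrow> fst s = 1) \<and> (\<forall>m. snd s m \<in> X \<and> dist (snd s m) (snd s (Suc m)) < D k)
      \<and> snd s 0 = x \<and> (\<forall>m\<ge>fst s. snd s m = y)" for k and s :: "nat \<times> (nat \<Rightarrow> 'a)"
    define Q where "Q k s s' \<longleftrightarrow> (\<exists>N\<ge>1. fst s' = fst s * N \<and> (\<forall>m. dist (snd s (m div N)) (snd s' m) < E k))"
      for k and s s' :: "nat \<times> (nat \<Rightarrow> 'a)"
    have "\<exists>S. \<forall>k. P k (S k) \<and> Q k (S k) (S (Suc k))"
    proof (rule dependent_nat_choice)
      show "\<exists>s. P 0 s"
        unfolding P_def using xy D(1)[of 0]
        by (intro exI[of _ "(1, \<lambda>m. if m = 0 then x else y)"]) auto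
      fix s k assume s: "P k s"
      obtain M c where sM: "s = (M, c)" by force
      have c: "M \<ge> 1" "\<And>m. c m \<in> X" "\<And>m. dist (c m) (c (Suc m)) < D k" "c 0 = x" "\<And>m. m \<ge> M \<Longrightarrow> c m = y"
        using s by (auto simp: P_def sM)
      obtain N c' where c': "N \<ge> 1" "\<And>m. c' m \<in> X" "\<And>m. dist (c' m) (c' (Suc m)) < D (Suc k)"
        "\<And>m. m \<ge> M * N \<Longrightarrow> c' m = y" "\<And>m. c' (m * N) = c m" "\<And>m. dist (c (m div N)) (c' m) < E k"
        using refine_chain[of X "D k" "E k" c M y "D (Suc k)", OF D(3) c(2,3,5) D(1)] by blast
      have "P (Suc k) (M * N, c')"
        using c' c(1,4) c'(5)[of 0] by (auto simp: P_def Suc_le_eq)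
      moreover have "Q k s (M * N, c')"
        using c' by (auto simp: Q_def sM)
      ultimately show "\<exists>s'. P (Suc k) s' \<and> Q k s s'" by blast
    qed
    then obtain S where S: "\<And>k. P k (S k)" "\<And>k. Q k (S k) (S (Suc k))" by blast
    define M where "M k = fst (S k)" for k
    define c where "c k = snd (S k)" for k
    have M: "M k \<ge> 1" and c: "c k m \<in> X" "dist (c k m) (c k (Suc m)) < D k" "c k 0 = x"
      "m \<ge> M k \<Longrightarrow> c k m = y" "M 0 = 1" for k m
      using S(1)[of 0] S(1)[of k] by (auto simp: P_def M_def c_def)
    define h where "h k t = c k (nat \<lfloor>t * real (M k)\<rfloor>)" for k t
    have h_step: "dist (h k t) (h (Suc k) t) \<le> \<epsilon>/4 / 2^k" if "t \<ge> 0" for k t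
    proof -
      obtain N where N: "N \<ge> 1" "M (Suc k) = M k * N" "\<And>m. dist (c k (m div N)) (c (Suc k) m) < E k"
        using S(2)[of k] by (auto simp: Q_def M_def c_def)
      have "\<lfloor>t * real (M k)\<rfloor> = \<lfloor>t * real (M (Suc k)) / real_of_int (int N)\<rfloor>"
        using N by simp
      also have "\<dots> = \<lfloor>t * real (M (Suc k))\<rfloor> div int N"
        by (rule floor_divide_real_eq_div) simp
      finally have "nat \<lfloor>t * real (M k)\<rfloor> = nat \<lfloor>t * real (M (Suc k))\<rfloor> div N"
        using that by (simp add: nat_div_distrib)
      then show ?thesis using N(3)[of "nat \<lfloor>t * real (M (Suc k))\<rfloor>"] by (simp add: h_def E_def)
    qed
    have "\<exists>l\<in>X. \<forall>k. dist (h k t) l \<le> 2 * (\<epsilon>/4) / 2^k" if "t \<ge> 0" for t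
    proof -
      have "complete X" using \<open>compact X\<close> by (rule compact_imp_complete)
      then show ?thesis
        by (rule geometric_Cauchy_limit[of X "\<lambda>k. h k t" "\<epsilon>/4"])
          (use that h_step c in \<open>auto simp: h_def\<close>)
    qed
    then obtain \<gamma> where \<gamma>: "\<And>t. t \<ge> 0 \<Longrightarrow> \<gamma> t \<in> X" "\<And>t k. t \<ge> 0 \<Longrightarrow> dist (h k t) (\<gamma> t) \<le> 2 * E k"
      unfolding E_def by (metis times_divide_eq_right)
    have Elim: "E \<longlonglongrightarrow> 0"
      unfolding E_def by (rule LIMSEQ_divide_realpow_zero) simp
    have "continuous_on {0..1} \<gamma>"
      unfolding continuous_on_iff
    proof (intro ballI allI impI)
      fix t e :: real assume t: "t \<in> {0..1}" and "e > 0"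
      then obtain k where k: "E k < e/5"
        using order_tendstoD(2)[OF Elim, of "e/5"] by (auto simp: eventually_sequentially)
      show "\<exists>d>0. \<forall>s\<in>{0..1}. dist s t < d \<longrightarrow> dist (\<gamma> s) (\<gamma> t) < e"
      proof (intro exI[of _ "1 / real (M k)"] conjI ballI impI)
        show "1 / real (M k) > 0" using M[of k] by simp
        fix s :: real assume s: "s \<in> {0..1}" "dist s t < 1 / real (M k)"
        \<comment> \<open>Arguments closer than one grid step fall into the same or into adjacent steps.\<close>
        have "\<bar>s * real (M k) - t * real (M k)\<bar> < 1"
        proof -
          have "\<bar>s - t\<bar> * real (M k) < 1"
            using s(2) M[of k] by (simp add: dist_real_def pos_less_divide_eq)
          then show ?thesis by (simp add: abs_mult flip: left_diff_distrib)
        qed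
        then have "\<bar>\<lfloor>s * real (M k)\<rfloor> - \<lfloor>t * real (M k)\<rfloor>\<bar> \<le> 1" by linarith
        moreover have "0 \<le> \<lfloor>s * real (M k)\<rfloor>" "0 \<le> \<lfloor>t * real (M k)\<rfloor>" using s t by auto
        ultimately consider "nat \<lfloor>s * real (M k)\<rfloor> = nat \<lfloor>t * real (M k)\<rfloor>"
          | "nat \<lfloor>s * real (M k)\<rfloor> = Suc (nat \<lfloor>t * real (M k)\<rfloor>)"
          | "nat \<lfloor>t * real (M k)\<rfloor> = Suc (nat \<lfloor>s * real (M k)\<rfloor>)" by linarith
        then have "dist (h k s) (h k t) < D k"
          using c(2)[of k] D(1)[of k] unfolding h_def by cases (auto simp: dist_commute)
        moreover have "dist (h k s) (\<gamma> s) \<le> 2 * E k" "dist (h k t) (\<gamma> t) \<le> 2 * E k"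
          using \<gamma> s t by auto
        moreover have "dist (\<gamma> s) (\<gamma> t) \<le> dist (h k s) (\<gamma> s) + dist (h k s) (h k t) + dist (h k t) (\<gamma> t)"
          by metric
        ultimately show "dist (\<gamma> s) (\<gamma> t) < e" using k D(2)[of k] by linarith
      qed
    qed
    moreover have const: "\<gamma> t = z" if "t \<ge> 0" "\<And>k. h k t = z" for t z
    proof -
      have "dist z (\<gamma> t) \<le> 0"
        using \<gamma>(2)[OF that(1)] that(2)
        by (intro LIMSEQ_le_const[OF tendsto_mult_right_zero[OF Elim, of 2]]) auto
      then show ?thesis by simp
    qed
    have "\<gamma> 0 = x" "\<gamma> 1 = y"
      by (rule const; simp add: h_def c)+
    moreover have "dist x (\<gamma> t) < \<epsilon>" if "t \<in> {0..1}" for t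
    proof -
      have "h 0 t \<in> {x, y}"
        unfolding h_def using c(3)[of 0] c(4)[of 0] c(5) by (cases "nat \<lfloor>t * real (M 0)\<rfloor>") auto
      then have "dist x (h 0 t) < \<epsilon>/4"
        using xy(3) D(2)[of 0] \<open>\<epsilon> > 0\<close> by (auto simp: E_def)
      moreover have "dist (h 0 t) (\<gamma> t) \<le> \<epsilon>/2" using \<gamma>(2)[of t 0] that by (simp add: E_def)
      ultimately show ?thesis using dist_triangle[of x "\<gamma> t" "h 0 t"] \<open>\<epsilon> > 0\<close> by linarith
    qed
    ultimately show "\<exists>\<gamma>::real \<Rightarrow> 'a. continuous_on {0..1} \<gamma> \<and>
       \<gamma> 0 = x \<and> \<gamma> 1 = y \<and> \<gamma> \<in> {0..1} \<rightarrow> X \<and> (\<forall>t\<in>{0..1}. dist x (\<gamma> t) < \<epsilon>)"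
      using \<gamma>(1) by (intro exI[of _ \<gamma>]) auto
  qed
qed

section \<open>Dimension zero by small separated pieces\<close>

text \<open>
  The classes of \<open>k\<close> cut \<open>C\<close> into finitely many pieces of diameter at most \<open>\<delta>\<close> (points of a piece are less
  than \<open>\<delta>\<close> apart) that are at distance at least \<open>\<eta>\<close> from each other.  The number \<open>\<eta>\<close> replaces
  compactness: a labelling passes to subsets and to neighbourhoods without any topological argument.
\<close>

definition labelling :: "'a::metric_space set \<Rightarrow> ('a \<Rightarrow> nat) \<Rightarrow> real \<Rightarrow> real \<Rightarrow> bool"
  where "labelling C k \<eta> \<delta> \<longleftrightarrow> \<eta> > 0 \<and> finite (k ` C) \<and>
    (\<forall>x\<in>C. \<forall>y\<in>C. (dist x y < \<eta> \<longrightarrow> k x = k y) \<and> (k x = k y \<longrightarrow> dist x y < \<delta>))"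

text \<open>
  For compact \<open>C\<close>, this says that \<open>C\<close> is at most \<open>0\<close>-dimensional.
\<close>

definition small_pieces :: "'a::metric_space set \<Rightarrow> bool"
  where "small_pieces C \<longleftrightarrow> (\<forall>\<delta>>0. \<exists>k \<eta>. labelling C k \<eta> \<delta>)"

lemma labelling_pos: "labelling C k \<eta> \<delta> \<Longrightarrow> \<eta> > 0"
  and labelling_finite: "labelling C k \<eta> \<delta> \<Longrightarrow> finite (k ` C)"
  and labelling_same: "\<lbrakk>labelling C k \<eta> \<delta>; x \<in> C; y \<in> C; dist x y < \<eta>\<rbrakk> \<Longrightarrow> k x = k y"
  and labelling_close: "\<lbrakk>labelling C k \<eta> \<delta>; x \<in> C; y \<in> C; k x = k y\<rbrakk> \<Longrightarrow> dist x y < \<delta>"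
  unfolding labelling_def by blast+

lemma labelling_subset: "\<lbrakk>labelling C k \<eta> \<delta>; D \<subseteq> C\<rbrakk> \<Longrightarrow> labelling D k \<eta> \<delta>"
  unfolding labelling_def using finite_subset[OF image_mono[of D C k]] by blast

lemma labelling_weaken: "\<lbrakk>labelling C k \<eta> \<delta>; \<delta> \<le> \<delta>'\<rbrakk> \<Longrightarrow> labelling C k \<eta> \<delta>'"
  unfolding labelling_def by (meson less_le_trans)

lemma small_pieces_singleton: "small_pieces {x}"
  unfolding small_pieces_def labelling_def 
  by (intro allI impI exI[of _ "\<lambda>_. 0"] exI[of _ 1]) simp

text \<open>
  A point near \<open>C\<close> gets the label of a nearby point of \<open>C\<close>; by \<open>3 * r \<le> \<eta>\<close> the choice of that point does
  not matter, and neighbouring points get the same label.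
\<close>

lemma labelling_thicken:
  assumes "labelling C k \<eta> \<delta>" "0 < r" "3 * r \<le> \<eta>"
  obtains k' where "labelling {x. \<exists>c\<in>C. dist c x < r} k' r (\<delta> + 2 * r)"
proof -
  let ?N = "{x. \<exists>c\<in>C. dist c x < r}"
  define p where "p x = (SOME c. c \<in> C \<and> dist c x < r)" for x
  have p: "p x \<in> C" "dist (p x) x < r" if "x \<in> ?N" for x
    using that someI_ex[of "\<lambda>c. c \<in> C \<and> dist c x < r"] unfolding p_def by auto
  have C: "finite (k ` C)" "\<And>x y. \<lbrakk>x \<in> C; y \<in> C; dist x y < \<eta>\<rbrakk> \<Longrightarrow> k x = k y"
    "\<And>x y. \<lbrakk>x \<in> C; y \<in> C; k x = k y\<rbrakk> \<Longrightarrow> dist x y < \<delta>"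
    using labelling_finite[OF assms(1)] labelling_same[OF assms(1)] labelling_close[OF assms(1)] by blast+
  have "labelling ?N (\<lambda>x. k (p x)) r (\<delta> + 2 * r)"
    unfolding labelling_def
  proof (intro conjI ballI impI)
    show "finite ((\<lambda>x. k (p x)) ` ?N)"
      by (rule finite_subset[OF _ C(1)]) (use p in blast)
    fix x y assume xy: "x \<in> ?N" "y \<in> ?N"
    note p[OF xy(1)] p[OF xy(2)]
    note p = this
    show "k (p x) = k (p y)" if "dist x y < r"
    proof -
      have "dist (p x) (p y) \<le> dist (p x) x + dist x y + dist (p y) y" by metric
      then show ?thesis using p that assms(3) by (intro C) auto
    qed
    show "dist x y < \<delta> + 2 * r" if "k (p x) = k (p y)"
    proof -
      have "dist x y \<le> dist (p x) x + dist (p x) (p y) + dist (p y) y" by metric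
      then show ?thesis using p C(3)[OF p(1,3) that] by linarith
    qed
  qed fact
  with that show ?thesis by blast
qed

lemma small_pieces_neighbourhood:
  assumes "small_pieces C" "\<delta> > 0"
  obtains k r where "labelling {x. \<exists>c\<in>C. dist c x < r} k r \<delta>"
proof -
  obtain k \<eta> where k: "labelling C k \<eta> (\<delta>/2)"
    using assms(1)[unfolded small_pieces_def, rule_format, of "\<delta>/2"] assms(2) by auto
  define r where "r = min (\<eta>/3) (\<delta>/4)"
  have r: "r > 0" "3 * r \<le> \<eta>" "\<delta>/2 + 2 * r \<le> \<delta>"
    using labelling_pos[OF k] \<open>\<delta> > 0\<close> by (auto simp: r_def)
  obtain k' where "labelling {x. \<exists>c\<in>C. dist c x < r} k' r (\<delta>/2 + 2*r)"
    using labelling_thicken[OF k r(1,2)] .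
  with r(3) that show ?thesis
    using labelling_weaken by blast
qed

text \<open>
  The sum theorem of dimension \<open>0\<close>, for sets that need not be disjoint.  The set \<open>C\<close> and all pieces of
  \<open>D\<close> that come close to it form a set \<open>E\<close> near \<open>C\<close>, where the labels of a neighbourhood of \<open>C\<close> apply;
  the remaining pieces of \<open>D\<close> are apart from \<open>E\<close> and keep their own labels.  Even and odd numbers keep
  the two kinds of labels different.
\<close>

lemma small_pieces_Un:
  assumes "small_pieces C" "small_pieces D"
  shows "small_pieces (C \<union> D)"
  unfolding small_pieces_def
proof (intro allI impI)
  fix \<delta> :: real assume "\<delta> > 0"
  obtain k1' r where k1': "labelling {x. \<exists>c\<in>C. dist c x < r} k1' r \<delta>"
    using small_pieces_neighbourhood[OF assms(1) \<open>\<delta> > 0\<close>] .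
  then have r: "r > 0" by (rule labelling_pos)
  obtain k2 \<eta>2 where k2: "labelling D k2 \<eta>2 (min (r/2) \<delta>)"
    using assms(2)[unfolded small_pieces_def, rule_format, of "min (r/2) \<delta>"] r \<open>\<delta> > 0\<close> by auto
  define E where "E = C \<union> {d\<in>D. \<exists>d'\<in>D. k2 d' = k2 d \<and> (\<exists>c\<in>C. dist c d' < r/2)}"
  have E: "E \<subseteq> {x. \<exists>c\<in>C. dist c x < r}"
  proof
    fix d assume "d \<in> E"
    then consider "d \<in> C" | d' c where "d \<in> D" "d' \<in> D" "k2 d' = k2 d" "c \<in> C" "dist c d' < r/2"
      by (auto simp: E_def)
    then show "d \<in> {x. \<exists>c\<in>C. dist c x < r}"
    proof cases
      case 2
      then have "dist d' d < r/2" using labelling_close[OF k2] by fastforce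
      then have "dist c d < r" using dist_triangle[of c d d'] \<open>dist c d' < r/2\<close> by simp
      with 2 show ?thesis by blast
    qed (use r in \<open>auto intro!: bexI[of _ d]\<close>)
  qed
  define k where "k x = (if x \<in> E then 2 * k1' x else 2 * k2 x + 1)" for x
  have lE: "labelling E k1' r \<delta>" using labelling_subset[OF k1' E] .
  have apart: "dist x y \<ge> min (r/2) \<eta>2" if "x \<in> E" "y \<in> C \<union> D" "y \<notin> E" for x y
  proof (rule ccontr)
    assume "\<not> ?thesis"
    then have d: "dist x y < r/2" "dist x y < \<eta>2" by auto
    have y: "y \<in> D" using that by (auto simp: E_def)
    show False
    proof (cases "x \<in> C")
      case True
      with d y have "y \<in> E" by (auto simp: E_def)
      with that show False by simp
    next
      case False
      with that obtain d' c where *: "x \<in> D" "d' \<in> D" "k2 d' = k2 x" "c \<in> C" "dist c d' < r/2"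
        by (auto simp: E_def)
      have "k2 x = k2 y" using labelling_same[OF k2 \<open>x \<in> D\<close> y] d by blast
      with * y have "y \<in> E" by (auto simp: E_def)
      with that show False by simp
    qed
  qed
  have parity: "2 * (a::nat) \<noteq> Suc (2 * b)" for a b by presburger
  have "labelling (C \<union> D) k (min (r/2) \<eta>2) \<delta>"
    unfolding labelling_def
  proof (intro conjI ballI)
    have "k ` (C \<union> D) \<subseteq> (\<lambda>i. 2 * i) ` k1' ` E \<union> (\<lambda>i. 2 * i + 1) ` k2 ` D"
      by (auto simp: k_def E_def)
    moreover have "finite ((\<lambda>i. 2 * i) ` k1' ` E \<union> (\<lambda>i. 2 * i + 1) ` k2 ` D)"
      using labelling_finite[OF lE] labelling_finite[OF k2] by simp
    ultimately show "finite (k ` (C \<union> D))" by (rule finite_subset)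
    show "min (r/2) \<eta>2 > 0" using r labelling_pos[OF k2] by auto
    fix x y assume xy: "x \<in> C \<union> D" "y \<in> C \<union> D"
    have D: "z \<in> D" if "z \<in> C \<union> D" "z \<notin> E" for z using that by (auto simp: E_def)
    consider "x \<in> E" "y \<in> E" | "x \<notin> E" "y \<notin> E" "x \<in> D" "y \<in> D"
      | "x \<in> E" "y \<notin> E" | "x \<notin> E" "y \<in> E"
      using xy D by blast
    then have "(dist x y < min (r/2) \<eta>2 \<longrightarrow> k x = k y) \<and> (k x = k y \<longrightarrow> dist x y < \<delta>)"
    proof cases
      case 1
      then show ?thesis
        using labelling_same[OF lE 1] labelling_close[OF lE 1] r by (auto simp: k_def)
    next
      case 2
      then show ?thesis
        using labelling_same[OF k2 2(3,4)] labelling_close[OF k2 2(3,4)] r by (auto simp: k_def)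
    next
      case 3
      then show ?thesis using apart[of x y] xy parity by (auto simp: k_def)
    next
      case 4
      then show ?thesis using apart[of y x] xy parity[of "k1' y" "k2 x"]
        by (auto simp: k_def dist_commute)
    qed
    then show "dist x y < min (r/2) \<eta>2 \<longrightarrow> k x = k y" "k x = k y \<longrightarrow> dist x y < \<delta>"
      by blast+
  qed
  then show "\<exists>k \<eta>. labelling (C \<union> D) k \<eta> \<delta>" by blast
qed

lemma small_pieces_UN:
  assumes "finite I" "\<And>i. i \<in> I \<Longrightarrow> small_pieces (C i)"
  shows "small_pieces (\<Union>i\<in>I. C i)"
  using assms
proof (induction I)
  case empty
  show ?case by (auto simp: small_pieces_def labelling_def intro!: exI[of _ 1])
qed (simp add: small_pieces_Un)

lemma compact_finite_pointed_cover:
  assumes "compact C" "\<And>x. x \<in> C \<Longrightarrow> openin (top_of_set C) (U x)" "\<And>x. x \<in> C \<Longrightarrow> x \<in> U x"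
  obtains n and p :: "nat \<Rightarrow> 'a::topological_space"
  where "\<And>m. m < n \<Longrightarrow> p m \<in> C" "C \<subseteq> (\<Union>m\<in>{..<n}. U (p m))"
proof -
  obtain T where T: "\<And>x. x \<in> C \<Longrightarrow> open (T x)" "\<And>x. x \<in> C \<Longrightarrow> U x = C \<inter> T x"
    using assms(2) unfolding openin_open by metis
  then have "C \<subseteq> (\<Union>x\<in>C. T x)" using assms(3) by auto
  then obtain F where F: "F \<subseteq> C" "finite F" "C \<subseteq> (\<Union>x\<in>F. T x)"
    using compactE_image[OF assms(1), of C T] T(1) by metis
  obtain n and p :: "nat \<Rightarrow> 'a" where p: "F = p ` {m. m < n}"
    using finite_imp_nat_seg_image_inj_on[OF F(2)] by auto
  have pC: "p m \<in> C" if "m < n" for m using p F(1) that by auto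
  have "C \<subseteq> (\<Union>m\<in>{..<n}. U (p m))"
  proof
    fix y assume "y \<in> C"
    with F p obtain m where "m < n" "y \<in> T (p m)" by blast
    with T(2)[OF pC] \<open>y \<in> C\<close> show "y \<in> (\<Union>m\<in>{..<n}. U (p m))" by blast
  qed
  with pC that show ?thesis by blast
qed

text \<open>
  Finitely many small clopen sets cover \<open>C\<close>.  Each point is labelled by the first of them that
  contains it; a clopen subset of a compact set has positive distance from its complement, which
  gives the separation constant.
\<close>

lemma compact_zero_dim_imp_small_pieces:
  fixes C :: "'a::metric_space set"
  assumes "compact C" "top_of_set C dim_le 0"
  shows "small_pieces C"
  unfolding small_pieces_def
proof (intro allI impI)
  fix \<delta> :: real assume "\<delta> > 0"
  have "\<exists>U. closedin (top_of_set C) U \<and> openin (top_of_set C) U \<and> x \<in> U \<and> U \<subseteq> ball x (\<delta>/2)"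
    if "x \<in> C" for x
  proof -
    have "openin (top_of_set C) (C \<inter> ball x (\<delta>/2))" "x \<in> C \<inter> ball x (\<delta>/2)"
      using that \<open>\<delta> > 0\<close> by auto
    then obtain U V where "openin (top_of_set C) U" "closedin (top_of_set C) V"
      "openin (top_of_set C) V" "x \<in> U" "U \<subseteq> V" "V \<subseteq> C \<inter> ball x (\<delta>/2)"
      using assms(2) unfolding dimension_le_0_neighbourhood_base_of_clopen neighbourhood_base_of
      by metis
    then show ?thesis by blast
  qed
  then obtain U where U: "\<And>x. x \<in> C \<Longrightarrow> closedin (top_of_set C) (U x)"
    "\<And>x. x \<in> C \<Longrightarrow> openin (top_of_set C) (U x)" "\<And>x. x \<in> C \<Longrightarrow> x \<in> U x"
    "\<And>x. x \<in> C \<Longrightarrow> U x \<subseteq> ball x (\<delta>/2)" by metis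
  obtain n p where pC: "\<And>m::nat. m < n \<Longrightarrow> p m \<in> C" and cover: "C \<subseteq> (\<Union>m\<in>{..<n}. U (p m))"
    using compact_finite_pointed_cover[OF assms(1) U(2,3)] by blast
  define k where "k x = (LEAST m. m < n \<and> x \<in> U (p m))" for x
  have k: "k x < n \<and> x \<in> U (p (k x))" if "x \<in> C" for x
  proof -
    have "\<exists>m. m < n \<and> x \<in> U (p m)" using that cover by auto
    then show ?thesis unfolding k_def by (rule LeastI_ex)
  qed
  have "\<exists>\<eta>>0. \<forall>x\<in>U (p m). \<forall>y\<in>C - U (p m). \<eta> \<le> dist x y" if "m < n" for m
  proof -
    have "compact (U (p m))" "compact (C - U (p m))"
      using closedin_compact[OF assms(1)] U(1)[OF pC[OF that]]
        closedin_diff[OF closedin_topspace U(2)[OF pC[OF that]]] by auto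
    then have "compact (U (p m))" "open (- (C - U (p m)))"
      using compact_imp_closed open_Compl by blast+
    then obtain e where "e > 0" "\<And>x. x \<in> U (p m) \<Longrightarrow> ball x e \<subseteq> - (C - U (p m))"
      using Heine_Borel_lemma[of "U (p m)" "{- (C - U (p m))}"] by auto
    then show ?thesis by (intro exI[of _ e]) (auto simp: subset_iff not_less[symmetric])
  qed
  then obtain \<eta> where \<eta>: "\<And>m. m < n \<Longrightarrow> \<eta> m > 0"
    "\<And>m x y. \<lbrakk>m < n; x \<in> U (p m); y \<in> C - U (p m)\<rbrakk> \<Longrightarrow> \<eta> m \<le> dist x y" by metis
  define e where "e = Min (insert 1 (\<eta> ` {..<n}))"
  have e: "e > 0" "\<And>m. m < n \<Longrightarrow> e \<le> \<eta> m" using \<eta>(1) by (auto simp: e_def)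
  have "labelling C k e \<delta>"
    unfolding labelling_def
  proof (intro conjI ballI impI)
    show "finite (k ` C)" by (rule finite_subset[of _ "{..<n}"]) (use k in auto)
    fix x y assume xy: "x \<in> C" "y \<in> C"
    show "dist x y < \<delta>" if "k x = k y"
    proof -
      have "x \<in> ball (p (k x)) (\<delta>/2)" "y \<in> ball (p (k x)) (\<delta>/2)"
        using k[OF xy(1)] k[OF xy(2)] that subsetD[OF U(4)[OF pC[of "k x"]]] by metis+
      then show ?thesis unfolding mem_ball using dist_triangle_half_r by blast
    qed
    show "k x = k y" if "dist x y < e"
    proof -
      have "x \<in> U (p m) \<longleftrightarrow> y \<in> U (p m)" if "m < n" for m
      proof (rule ccontr)
        assume "(x \<in> U (p m)) \<noteq> (y \<in> U (p m))"
        then have "\<eta> m \<le> dist x y \<or> \<eta> m \<le> dist y x"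
          using \<eta>(2)[OF that] xy by blast
        with e(2)[OF that] \<open>dist x y < e\<close> show False by (simp add: dist_commute)
      qed
      then have "(\<lambda>m. m < n \<and> x \<in> U (p m)) = (\<lambda>m. m < n \<and> y \<in> U (p m))" by auto
      then show ?thesis unfolding k_def by simp
    qed
  qed (rule e)
  then show "\<exists>k \<eta>. labelling C k \<eta> \<delta>" by blast
qed

lemma small_pieces_imp_zero_dim:
  assumes "small_pieces C"
  shows "top_of_set C dim_le 0"
  unfolding dimension_le_0_neighbourhood_base_of_clopen
proof (subst open_neighbourhood_base_of, blast, intro allI impI)
  show "\<exists>U. (closedin (top_of_set C) U \<and> openin (top_of_set C) U) \<and> x \<in> U \<and> U \<subseteq> W"
    if W: "openin (top_of_set C) W \<and> x \<in> W" for W x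
  proof -
    obtain \<delta> where \<delta>: "\<delta> > 0" "\<And>y. y \<in> C \<Longrightarrow> dist y x < \<delta> \<Longrightarrow> y \<in> W" and x: "x \<in> C"
      using W unfolding openin_euclidean_subtopology_iff by blast
    obtain k \<eta> where k: "labelling C k \<eta> \<delta>"
      using assms \<delta>(1) unfolding small_pieces_def by blast
    have op: "openin (top_of_set C) {y\<in>C. k y \<in> A}" for A
      unfolding openin_euclidean_subtopology_iff
    proof (intro conjI ballI)
      fix y assume y: "y \<in> {y\<in>C. k y \<in> A}"
      show "\<exists>e>0. \<forall>z\<in>C. dist z y < e \<longrightarrow> z \<in> {y\<in>C. k y \<in> A}"
      proof (intro exI[of _ \<eta>] conjI ballI impI)
        fix z assume "z \<in> C" "dist z y < \<eta>"
        then have "k z = k y" using labelling_same[OF k, of z y] y by blast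
        with y \<open>z \<in> C\<close> show "z \<in> {y\<in>C. k y \<in> A}" by simp
      qed (rule labelling_pos[OF k])
    qed blast
    have "C - {y\<in>C. k y \<in> {k x}} = {y\<in>C. k y \<in> - {k x}}" by auto
    then have "closedin (top_of_set C) {y\<in>C. k y \<in> {k x}}"
      using op[of "- {k x}"] by (auto simp: closedin_def)
    moreover have "{y\<in>C. k y \<in> {k x}} \<subseteq> W"
      using labelling_close[OF k _ x] \<delta>(2) by blast
    ultimately show ?thesis using op[of "{k x}"] x by blast
  qed
qed

section \<open>Cells, and gluing maps along cells\<close>

text \<open>
  The frontier of an open set \<open>U\<close> misses both \<open>U\<close> and every open set disjoint from \<open>U\<close>, so each open set
  can be shrunk past one frontier after another.
\<close>

lemma frontiers_nowhere_dense:
  assumes "finite I" "\<And>i. i \<in> I \<Longrightarrow> openin T (U i)" "openin T W" "W \<noteq> {}"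
  obtains V where "openin T V" "V \<noteq> {}" "V \<subseteq> W" "V \<inter> (\<Union>i\<in>I. T frontier_of U i) = {}"
proof -
  have "\<exists>V. openin T V \<and> V \<noteq> {} \<and> V \<subseteq> W \<and> V \<inter> (\<Union>i\<in>I. T frontier_of U i) = {}"
    using assms
  proof (induction I)
    case (insert i I)
    then obtain V where V: "openin T V" "V \<noteq> {}" "V \<subseteq> W" "V \<inter> (\<Union>i\<in>I. T frontier_of U i) = {}"
      by auto
    have Ui: "openin T (U i)" using insert by auto
    show ?case
    proof (cases "V \<inter> U i = {}")
      case True
      then have "V \<inter> T closure_of U i = {}"
        using openin_Int_closure_of_eq_empty[OF V(1)] by blast
      with V show ?thesis by (intro exI[of _ V]) (auto simp: frontier_of_def)
    next
      case False
      with V Ui show ?thesis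
        by (intro exI[of _ "V \<inter> U i"]) (auto simp: frontier_of_def interior_of_openin)
    qed
  qed auto
  with that show ?thesis by blast
qed

text \<open>
  Here dimension \<open>1\<close> enters: \<open>X\<close> has a finite cover by small open sets with \<open>0\<close>-dimensional frontiers.
  The union \<open>B\<close> of the frontiers consists of small pieces, and it cuts the rest of \<open>X\<close> into finitely
  many small open cells.  The index \<open>i x\<close> is that of the first cover element containing \<open>x\<close>.  A cell
  has limit points outside itself only in \<open>B\<close>, so it becomes closed when \<open>B\<close> is added.
\<close>

lemma small_cells:
  fixes X :: "'a::metric_space set"
  assumes "compact X" "top_of_set X dim_le 1" "\<delta> > 0"
  obtains B and i :: "'a \<Rightarrow> nat" where "compact B" "small_pieces B"
    "\<And>x e. \<lbrakk>x \<in> X; e > 0\<rbrakk> \<Longrightarrow> \<exists>p\<in>X - B. dist x p < e"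
    "finite (i ` X)" "\<And>m. closed (B \<union> {x\<in>X. i x = m})"
    "\<And>x y. \<lbrakk>x \<in> X; y \<in> X; i x = i y\<rbrakk> \<Longrightarrow> dist x y < \<delta>"
proof -
  let ?T = "top_of_set X"
  have "\<exists>U. openin ?T U \<and> a \<in> U \<and> U \<subseteq> ball a (\<delta>/2) \<and> top_of_set (?T frontier_of U) dim_le 0"
    if "a \<in> X" for a
  proof -
    have "openin ?T (X \<inter> ball a (\<delta>/2))" "a \<in> X \<inter> ball a (\<delta>/2)" using that \<open>\<delta> > 0\<close> by auto
    moreover have "\<forall>V a. openin ?T V \<and> a \<in> V \<longrightarrow>
        (\<exists>U. a \<in> U \<and> U \<subseteq> V \<and> openin ?T U \<and> subtopology ?T (?T frontier_of U) dim_le (1-1))"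
      using assms(2) by (subst (asm) dimension_le.simps) blast
    ultimately obtain U where U: "a \<in> U" "U \<subseteq> X \<inter> ball a (\<delta>/2)" "openin ?T U"
      "subtopology ?T (?T frontier_of U) dim_le (1-1)" by blast
    have "X \<inter> ?T frontier_of U = ?T frontier_of U"
      using frontier_of_subset_topspace[of ?T U] by auto
    with U show ?thesis by (intro exI[of _ U]) (auto simp: subtopology_subtopology)
  qed
  then obtain U where U: "\<And>a. a \<in> X \<Longrightarrow> openin ?T (U a)" "\<And>a. a \<in> X \<Longrightarrow> a \<in> U a"
    "\<And>a. a \<in> X \<Longrightarrow> U a \<subseteq> ball a (\<delta>/2)" "\<And>a. a \<in> X \<Longrightarrow> top_of_set (?T frontier_of U a) dim_le 0"
    by metis
  obtain n c where cX: "\<And>m::nat. m < n \<Longrightarrow> c m \<in> X" and cover: "X \<subseteq> (\<Union>m\<in>{..<n}. U (c m))"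
    using compact_finite_pointed_cover[OF assms(1) U(1,2)] by blast
  define V where "V m = U (c m)" for m
  have V: "openin ?T (V m)" "V m \<subseteq> ball (c m) (\<delta>/2)" "top_of_set (?T frontier_of V m) dim_le 0"
    if "m < n" for m using U(1,3,4)[OF cX[OF that]] by (auto simp: V_def)
  define B where "B = (\<Union>m\<in>{..<n}. ?T frontier_of V m)"
  define i where "i x = (LEAST m. m < n \<and> x \<in> V m)" for x
  have i: "i x < n" "x \<in> V (i x)" and i_least: "\<And>l. l < i x \<Longrightarrow> x \<notin> V l" if "x \<in> X" for x
  proof -
    have ex: "\<exists>m. m < n \<and> x \<in> V m" using that cover by (auto simp: V_def)
    show "i x < n" "x \<in> V (i x)" using LeastI_ex[OF ex] by (auto simp: i_def)
    then show "x \<notin> V l" if "l < i x" for l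
      using that not_less_Least[of l "\<lambda>m. m < n \<and> x \<in> V m"] unfolding i_def by auto
  qed
  have cl: "closed S" "compact S" if "closedin ?T S" for S
    using closedin_compact[OF assms(1) that] compact_imp_closed by blast+
  have BX: "closedin ?T B" unfolding B_def by (intro closedin_Union) (auto simp: closedin_frontier_of)
  show ?thesis
  proof
    show "compact B" using cl BX by blast
    show "small_pieces B"
      unfolding B_def
      by (intro small_pieces_UN compact_zero_dim_imp_small_pieces V cl) (auto simp: closedin_frontier_of)
    show "\<exists>p\<in>X - B. dist x p < e" if "x \<in> X" "e > 0" for x e
    proof -
      have W: "openin ?T (X \<inter> ball x e)" "X \<inter> ball x e \<noteq> {}" using that by auto
      obtain W where "openin ?T W" "W \<noteq> {}" "W \<subseteq> X \<inter> ball x e" "W \<inter> B = {}"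
        using frontiers_nowhere_dense[OF _ _ W, of "{..<n}" V] V(1) unfolding B_def by auto
      then show ?thesis by fastforce
    qed
    show "finite (i ` X)" by (rule finite_subset[of _ "{..<n}"]) (use i in auto)
    show "dist x y < \<delta>" if "x \<in> X" "y \<in> X" "i x = i y" for x y
    proof -
      have "x \<in> ball (c (i x)) (\<delta>/2)" "y \<in> ball (c (i x)) (\<delta>/2)"
        using i[OF that(1)] i[OF that(2)] that(3) V(2)[of "i x"] by auto
      then show ?thesis unfolding mem_ball using dist_triangle_half_r by blast
    qed
    show "closed (B \<union> {x\<in>X. i x = m})" for m
    proof (cases "m < n")
      case True
      \<comment> \<open>Off \<open>B\<close>, membership in \<open>V m\<close> is the same as membership in its closure.\<close>
      have "B \<union> {x\<in>X. i x = m} = B \<union> (?T closure_of V m - (\<Union>l\<in>{..<m}. V l))" (is "?L = ?R")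
      proof -
        have "x \<in> ?L \<longleftrightarrow> x \<in> ?R" if "x \<notin> B" for x
        proof
          assume "x \<in> ?L"
          then have "x \<in> X" "i x = m" using that by auto
          then show "x \<in> ?R"
            using i[of x] i_least[of x] closure_of_subset[of "V m" ?T] openin_subset[OF V(1)[OF True]]
            by auto
        next
          assume "x \<in> ?R"
          then have x: "x \<in> ?T closure_of V m" "\<And>l. l < m \<Longrightarrow> x \<notin> V l" using that by auto
          have "x \<notin> ?T frontier_of V m" using that True by (auto simp: B_def)
          then have "x \<in> V m" using x(1) V(1)[OF True] by (auto simp: frontier_of_def interior_of_openin)
          moreover have "x \<in> X" using x(1) closure_of_subset_topspace[of ?T "V m"] by auto
          moreover have "i x = m"
            unfolding i_def by (rule Least_equality) (use x True \<open>x \<in> V m\<close> not_less in blast)+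
          ultimately show "x \<in> ?L" by auto
        qed
        then show ?thesis by blast
      qed
      moreover have "closedin ?T ?R"
        by (intro closedin_Un BX closedin_diff closedin_closure_of openin_Union) (use V True in auto)
      ultimately show ?thesis using cl(1) by metis
    next
      case False
      then have empty: "{x\<in>X. i x = m} = {}" using i by auto
      show ?thesis unfolding empty using cl(1)[OF BX] by simp
    qed
  qed
qed

text \<open>
  The distance from \<open>B\<close>, with a positive constant in place of the value \<open>0\<close> of \<open>infdist\<close> when \<open>B\<close> is empty.
\<close>

lemma cutoff_distance:
  fixes B :: "'a::metric_space set"
  assumes "closed B" "r > 0"
  obtains \<rho> :: "'a \<Rightarrow> real" where "continuous_on UNIV \<rho>" "\<And>x. \<rho> x \<ge> 0" "\<And>x. \<rho> x = 0 \<longleftrightarrow> x \<in> B"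
    "\<And>x y. \<rho> x \<le> \<rho> y + dist x y" "\<And>x s. \<lbrakk>\<rho> x < s; s \<le> r\<rbrakk> \<Longrightarrow> \<exists>b\<in>B. dist b x < s"
proof (cases "B = {}")
  case True
  then show ?thesis using \<open>r > 0\<close> by (intro that[of "\<lambda>_. r"]) auto
next
  case False
  show ?thesis
  proof (rule that[of "\<lambda>x. infdist x B"])
    show "infdist x B = 0 \<longleftrightarrow> x \<in> B" for x
      using in_closed_iff_infdist_zero[OF assms(1) False] by blast
    show "\<exists>b\<in>B. dist b x < s" if "infdist x B < s" for x s
      using that cINF_less_iff[OF False bdd_below_image_dist, of x s] False
      by (auto simp: infdist_notempty dist_commute[of x])
  qed (auto intro!: continuous_intros infdist_nonneg infdist_triangle)
qed

text \<open>
  Gluing a map from constants on cells and paths between cells.  Far from the set \<open>\<rho> x = 0\<close> the map is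
  the constant \<open>p m\<close> on the cell \<open>i x = m\<close>.  Near that set the piece \<open>k x = j\<close> also counts, and the map
  runs along the path \<open>\<Gamma> j m\<close> as \<open>\<rho>\<close> grows from \<open>0\<close> to \<open>s\<close>.  All paths of a piece start at the same point,
  so the cells fit together along \<open>\<rho> x = 0\<close>.  Continuity follows from a finite closed cover, as each
  cell united with the zero set of \<open>\<rho>\<close> is closed.
\<close>

lemma continuous_on_interpolation:
  fixes \<Gamma> :: "nat \<Rightarrow> nat \<Rightarrow> real \<Rightarrow> 'b::topological_space"
  assumes "closed X" "continuous_on X \<rho>" "s > 0" "\<And>x. \<rho> x \<ge> 0"
    and fin: "finite (i ` X)" "finite (k ` {x\<in>X. \<rho> x \<le> s})"
    and cell: "\<And>m. closed ({x\<in>X. \<rho> x = 0} \<union> {x\<in>X. i x = m})"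
    and piece: "\<And>j. closed {x\<in>X. \<rho> x \<le> s \<and> k x = j}"
    and cont: "\<And>j m. \<lbrakk>j \<in> k ` {x\<in>X. \<rho> x \<le> s}; m \<in> i ` X\<rbrakk> \<Longrightarrow> continuous_on {0..1} (\<Gamma> j m)"
    and start: "\<And>j m m'. \<lbrakk>j \<in> k ` {x\<in>X. \<rho> x \<le> s}; m \<in> i ` X; m' \<in> i ` X\<rbrakk> \<Longrightarrow> \<Gamma> j m 0 = \<Gamma> j m' 0"
    and finish: "\<And>x. \<lbrakk>x \<in> X; \<rho> x \<le> s\<rbrakk> \<Longrightarrow> \<Gamma> (k x) (i x) 1 = p (i x)"
  shows "continuous_on X (\<lambda>x. if \<rho> x \<le> s then \<Gamma> (k x) (i x) (\<rho> x / s) else p (i x))"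
    (is "continuous_on X ?g")
proof -
  let ?J = "{x\<in>X. \<rho> x \<le> s}"
  let ?C = "\<lambda>m. {x\<in>X. \<rho> x = 0} \<union> {x\<in>X. i x = m}"
  have closed_far: "closed {x\<in>X. s \<le> \<rho> x}"
    using continuous_on_closed_Collect_le[OF continuous_on_const assms(2,1)] .
  have near: "continuous_on (\<Union>(j,m)\<in>k ` ?J \<times> i ` X. ?C m \<inter> {x\<in>X. \<rho> x \<le> s \<and> k x = j}) ?g"
  proof (rule continuous_on_closed_Union)
    show "finite (k ` ?J \<times> i ` X)" using fin by simp
    fix jm assume "jm \<in> k ` ?J \<times> i ` X"
    then obtain j m where jm: "jm = (j, m)" "j \<in> k ` ?J" "m \<in> i ` X" by auto
    let ?S = "?C m \<inter> {x\<in>X. \<rho> x \<le> s \<and> k x = j}"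
    have "closed ?S" using cell piece by (rule closed_Int)
    then show "closed (case jm of (j, m) \<Rightarrow> ?C m \<inter> {x\<in>X. \<rho> x \<le> s \<and> k x = j})" by (simp add: jm)
    have "continuous_on ?S (\<lambda>x. \<Gamma> j m (\<rho> x / s))"
      by (rule continuous_on_compose2[OF cont[OF jm(2,3)]])
        (use assms(3,4) in \<open>auto intro!: continuous_intros continuous_on_subset[OF assms(2)]\<close>)
    moreover have "\<Gamma> j m (\<rho> x / s) = ?g x" if "x \<in> ?S" for x
      using that start[OF jm(2), of "i x" m] jm(3) by auto
    ultimately have "continuous_on ?S ?g" by (rule continuous_on_eq)
    then show "continuous_on (case jm of (j, m) \<Rightarrow> ?C m \<inter> {x\<in>X. \<rho> x \<le> s \<and> k x = j}) ?g"
      by (simp add: jm)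
  qed
  have far: "continuous_on (\<Union>m\<in>i ` X. ?C m \<inter> {x\<in>X. s \<le> \<rho> x}) ?g"
  proof (rule continuous_on_closed_Union)
    fix m assume "m \<in> i ` X"
    show "closed (?C m \<inter> {x\<in>X. s \<le> \<rho> x})" using cell closed_far by (rule closed_Int)
    have "p m = ?g x" if "x \<in> ?C m \<inter> {x\<in>X. s \<le> \<rho> x}" for x
      using that finish[of x] assms(3) by (cases "\<rho> x = s") auto
    then show "continuous_on (?C m \<inter> {x\<in>X. s \<le> \<rho> x}) ?g"
      by (rule continuous_on_eq[OF continuous_on_const])
  qed (rule fin)
  have "closed (case jm of (j, m) \<Rightarrow> ?C m \<inter> {x\<in>X. \<rho> x \<le> s \<and> k x = j})" for jm
    by (cases jm) (simp only: prod.case, intro closed_Int cell piece)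
  then have clo: "closed (\<Union>(j,m)\<in>k ` ?J \<times> i ` X. ?C m \<inter> {x\<in>X. \<rho> x \<le> s \<and> k x = j})"
    "closed (\<Union>m\<in>i ` X. ?C m \<inter> {x\<in>X. s \<le> \<rho> x})"
    by (intro closed_UN ballI finite_cartesian_product fin closed_Int cell closed_far; blast)+
  have "X = (\<Union>(j,m)\<in>k ` ?J \<times> i ` X. ?C m \<inter> {x\<in>X. \<rho> x \<le> s \<and> k x = j})
    \<union> (\<Union>m\<in>i ` X. ?C m \<inter> {x\<in>X. s \<le> \<rho> x})"
    by auto
  with continuous_on_closed_Un[OF clo near far] show ?thesis by metis
qed

section \<open>Density of maps with small chain recurrent pieces\<close>

text \<open>
  The approximation of \<open>CR X f\<close> at one fixed scale.  When \<open>\<epsilon>\<close> is halved and \<open>f\<close> is replaced by a map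
  within \<open>\<epsilon>/2\<close> of it, this set can only shrink.
\<close>

definition eps_CR :: "'a::metric_space set \<Rightarrow> ('a \<Rightarrow> 'a) \<Rightarrow> real \<Rightarrow> 'a set"
  where "eps_CR X f \<epsilon> = {x. \<exists>n c. eps_chain X f \<epsilon> x x n c}"

text \<open>
  Outside \<open>\<rho> x \<le> s\<close> the map takes values in \<open>P\<close>, and points close to \<open>P\<close> are again outside.  A chain that
  starts outside is therefore near \<open>P\<close> after every step.
\<close>

lemma trapped_chain:
  assumes "eps_chain X g e x y n c" "\<not> \<rho> x \<le> s"
    and into: "\<And>x. \<lbrakk>x \<in> X; \<not> \<rho> x \<le> s\<rbrakk> \<Longrightarrow> g x \<in> P"
    and avoid: "\<And>x q. \<lbrakk>x \<in> X; q \<in> P; dist q x < e\<rbrakk> \<Longrightarrow> \<not> \<rho> x \<le> s"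
  shows "\<exists>q\<in>P. dist q y < e"
proof -
  have c: "n \<ge> 1" "c 0 = x" "c n = y" "\<And>i. i \<le> n \<Longrightarrow> c i \<in> X"
    "\<And>i. i \<in> {1..n} \<Longrightarrow> dist (g (c (i - 1))) (c i) < e"
    using assms(1) by (auto simp: eps_chain_def)
  have out: "\<not> \<rho> (c i) \<le> s" if "i \<le> n" for i
    using that
  proof (induction i)
    case (Suc i)
    then have "g (c i) \<in> P" "dist (g (c i)) (c (Suc i)) < e"
      using c(4)[of i] c(5)[of "Suc i"] into by auto
    with Suc show ?case using avoid c(4) by blast
  qed (use c assms(2) in auto)
  have "g (c (n - 1)) \<in> P" using into[of "c (n-1)"] c(4)[of "n-1"] out[of "n-1"] by simp
  with c(1,3) c(5)[of n] show ?thesis by force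
qed

lemma finite_avoids_closed:
  fixes P :: "'a::metric_space set"
  assumes "finite P" "closed B" "P \<inter> B = {}"
  obtains r where "r > 0" "\<And>q b. \<lbrakk>q \<in> P; b \<in> B\<rbrakk> \<Longrightarrow> r \<le> dist b q"
proof -
  have "P \<subseteq> \<Union>{- B}" using assms(3) by auto
  then obtain r where "r > 0" "\<And>q. q \<in> P \<Longrightarrow> ball q r \<subseteq> - B"
    using Heine_Borel_lemma[OF finite_imp_compact[OF assms(1)], of "{- B}"] assms(2)
    by (auto simp: open_Compl)
  then show ?thesis using that[of r] by (fastforce simp: subset_iff dist_commute not_less[symmetric])
qed

text \<open>
  The maps with small chain recurrent pieces are dense.  The map \<open>g\<close> sends the cell with index \<open>m\<close>, up
  to a thin neighbourhood \<open>?J\<close> of \<open>B\<close>, to one point \<open>p m\<close> near its image under \<open>f\<close>.  In the part of \<open>?J\<close>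
  around one piece \<open>j\<close> of \<open>B\<close>, it follows short paths from a common point \<open>q j\<close> to the points \<open>p m\<close> of
  the cells that meet there.  Since \<open>B\<close> is nowhere dense, the points \<open>p m\<close> can be chosen off \<open>B\<close>, and
  then \<open>?J\<close> so thin that it stays away from them.  By \<open>trapped_chain\<close>, a chain recurrent point lies in
  \<open>?J\<close> or near the finite set \<open>P\<close> of all \<open>p m\<close>, and a neighbourhood of \<open>B \<union> P\<close> has small pieces.
\<close>

lemma chain_recurrence_perturbation:
  fixes X :: "'a::metric_space set"
  assumes X: "compact X" "locally connected X" "top_of_set X dim_le 1"
    and f: "continuous_on X f" "f \<in> X \<rightarrow> X" and pos: "\<epsilon> > 0" "\<delta> > 0"
  obtains g e k \<eta> where "continuous_on X g" "g \<in> X \<rightarrow> X" "\<And>x. x \<in> X \<Longrightarrow> dist (f x) (g x) < \<epsilon>"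
    "e > 0" "labelling (eps_CR X g e) k \<eta> \<delta>"
proof -
  obtain \<delta>1 where \<delta>1: "\<delta>1 > 0" "\<delta>1 \<le> \<epsilon>/3" and path: "\<And>x y. \<lbrakk>x \<in> X; y \<in> X; dist x y < \<delta>1\<rbrakk> \<Longrightarrow>
    \<exists>\<gamma>::real \<Rightarrow> 'a. continuous_on {0..1} \<gamma> \<and> \<gamma> 0 = x \<and> \<gamma> 1 = y \<and> \<gamma> \<in> {0..1} \<rightarrow> X \<and>
      (\<forall>t\<in>{0..1}. dist x (\<gamma> t) < \<epsilon>/3)"
    using compact_locally_connected_uniform_paths[OF X(1,2), of "\<epsilon>/3"] pos(1) by auto
  have "uniformly_continuous_on X f" using f(1) X(1) by (rule compact_uniformly_continuous)
  then obtain \<delta>2 where \<delta>2: "\<delta>2 > 0"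
    "\<And>x y. \<lbrakk>x \<in> X; y \<in> X; dist x y < \<delta>2\<rbrakk> \<Longrightarrow> dist (f x) (f y) < \<delta>1/3"
    unfolding uniformly_continuous_on_def using \<delta>1(1) by (metis dist_commute zero_less_divide_iff zero_less_numeral)
  obtain B and i :: "'a \<Rightarrow> nat" where B: "compact B" "small_pieces B"
    "\<And>x e. \<lbrakk>x \<in> X; e > 0\<rbrakk> \<Longrightarrow> \<exists>p\<in>X - B. dist x p < e"
    and i: "finite (i ` X)" "\<And>m. closed (B \<union> {x\<in>X. i x = m})"
    "\<And>x y. \<lbrakk>x \<in> X; y \<in> X; i x = i y\<rbrakk> \<Longrightarrow> dist x y < \<delta>2"
    by (rule small_cells[OF X(1,3) \<delta>2(1)]) blast
  have "\<forall>m\<in>i ` X. \<exists>p\<in>X - B. \<forall>x\<in>X. i x = m \<longrightarrow> dist (f x) p < 2*\<delta>1/3"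
  proof
    fix m assume "m \<in> i ` X"
    then obtain a where a: "a \<in> X" "i a = m" by auto
    with f(2) \<delta>1(1) B(3)[of "f a" "\<delta>1/3"] obtain p where p: "p \<in> X - B" "dist (f a) p < \<delta>1/3" by auto
    have "dist (f x) p < 2*\<delta>1/3" if "x \<in> X" "i x = m" for x
      using dist_triangle[of "f x" p "f a"] \<delta>2(2)[OF that(1) a(1) i(3)] that a p by auto
    with p show "\<exists>p\<in>X - B. \<forall>x\<in>X. i x = m \<longrightarrow> dist (f x) p < 2*\<delta>1/3" by blast
  qed
  then obtain p where p: "\<And>x. x \<in> X \<Longrightarrow> p (i x) \<in> X - B" "\<And>x. x \<in> X \<Longrightarrow> dist (f x) (p (i x)) < 2*\<delta>1/3"
    by (metis imageI)
  define P where "P = p ` i ` X"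
  have P: "finite P" "P \<inter> B = {}" using i(1) p(1) by (auto simp: P_def)
  have "small_pieces (\<Union>q\<in>P. {q})" using P(1) small_pieces_singleton by (rule small_pieces_UN)
  then have small: "small_pieces (B \<union> P)" using small_pieces_Un[OF B(2)] by simp
  have "min \<delta> \<delta>2 > 0" using pos(2) \<delta>2(1) by simp
  from small_pieces_neighbourhood[OF small this] obtain k r0 where k: "labelling {x. \<exists>c\<in>B \<union> P. dist c x < r0} k r0 (min \<delta> \<delta>2)"
    by blast
  have closedB: "closed B" using B(1) by (rule compact_imp_closed)
  obtain r1 where r1: "r1 > 0" "\<And>q b. \<lbrakk>q \<in> P; b \<in> B\<rbrakk> \<Longrightarrow> r1 \<le> dist b q"
    using finite_avoids_closed[OF P(1) closedB P(2)] by blast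
  \<comment> \<open>The radius of \<open>?J\<close>: within \<open>2 * s\<close> of \<open>B\<close>, the labelling \<open>k\<close> is available and there is no
      point of \<open>P\<close>.\<close>
  define s where "s = min r0 r1 / 2"
  have s: "s > 0" "2 * s \<le> r0" "2 * s \<le> r1" using r1(1) labelling_pos[OF k] by (auto simp: s_def)
  obtain \<rho> where \<rho>: "continuous_on UNIV \<rho>" "\<And>x. \<rho> x \<ge> 0" "\<And>x. \<rho> x = 0 \<longleftrightarrow> x \<in> B"
    "\<And>x y. \<rho> x \<le> \<rho> y + dist x y" "\<And>x t. \<lbrakk>\<rho> x < t; t \<le> 2 * s\<rbrakk> \<Longrightarrow> \<exists>b\<in>B. dist b x < t"
    by (rule cutoff_distance[OF closedB, of "2 * s"]) (use s(1) in simp, blast)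
  let ?N = "{x. \<exists>c\<in>B \<union> P. dist c x < r0}"
  let ?J = "{x\<in>X. \<rho> x \<le> s}"
  have JN: "?J \<subseteq> ?N"
  proof
    fix x assume "x \<in> ?J"
    then have "\<rho> x < 2 * s" using s(1) by simp
    from \<rho>(5)[OF this order_refl] show "x \<in> ?N" using s(2) less_le_trans by blast
  qed
  have "\<forall>j\<in>k ` ?J. \<exists>q\<in>X. \<forall>x\<in>?J. k x = j \<longrightarrow> dist (f x) q < \<delta>1/3"
  proof
    fix j assume "j \<in> k ` ?J"
    then obtain b where b: "b \<in> ?J" "k b = j" by blast
    have "dist (f x) (f b) < \<delta>1/3" if "x \<in> ?J" "k x = j" for x
      using \<delta>2(2)[of x b] labelling_close[OF k, of x b] JN that b by auto
    with b f(2) show "\<exists>q\<in>X. \<forall>x\<in>?J. k x = j \<longrightarrow> dist (f x) q < \<delta>1/3" by blast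
  qed
  then obtain q where q: "\<And>x. x \<in> ?J \<Longrightarrow> q (k x) \<in> X" "\<And>x. x \<in> ?J \<Longrightarrow> dist (f x) (q (k x)) < \<delta>1/3"
    by (metis (no_types, lifting) imageI)
  \<comment> \<open>Paths are needed only between close points; constant paths for the other pairs make the
      choice total on \<open>X\<close>.\<close>
  define good where "good x y \<gamma> \<longleftrightarrow> continuous_on {0..1} \<gamma> \<and> \<gamma> 0 = x \<and> (dist x y < \<delta>1 \<longrightarrow> \<gamma> 1 = y) \<and>
    \<gamma> \<in> {0..1} \<rightarrow> X \<and> (\<forall>t\<in>{0..1}. dist x (\<gamma> t) < \<epsilon>/3)" for x y and \<gamma> :: "real \<Rightarrow> 'a"
  have "\<exists>\<gamma>. good x y \<gamma>" if "x \<in> X" "y \<in> X" for x y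
  proof (cases "dist x y < \<delta>1")
    case True
    with path[OF that] show ?thesis unfolding good_def by blast
  next
    case False
    with that pos(1) show ?thesis by (intro exI[of _ "\<lambda>_. x"]) (auto simp: good_def)
  qed
  then obtain \<Gamma> where good: "\<And>x y. \<lbrakk>x \<in> X; y \<in> X\<rbrakk> \<Longrightarrow> good x y (\<Gamma> x y)" by metis
  have \<Gamma>: "continuous_on {0..1} (\<Gamma> x y)" "\<Gamma> x y 0 = x" "dist x y < \<delta>1 \<Longrightarrow> \<Gamma> x y 1 = y"
    "\<Gamma> x y \<in> {0..1} \<rightarrow> X" "t \<in> {0..1} \<Longrightarrow> dist x (\<Gamma> x y t) < \<epsilon>/3" if "x \<in> X" "y \<in> X" for x y t
    using good[OF that] unfolding good_def by blast+
  define g where "g x = (if \<rho> x \<le> s then \<Gamma> (q (k x)) (p (i x)) (\<rho> x / s) else p (i x))" for x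
  have closedX: "closed X" using X(1) by (rule compact_imp_closed)
  have cont\<rho>: "continuous_on X \<rho>" using \<rho>(1) by (rule continuous_on_subset) simp
  have unit: "\<rho> x / s \<in> {0..1}" if "\<rho> x \<le> s" for x using that \<rho>(2)[of x] s(1) by auto
  have "continuous_on X (\<lambda>x. if \<rho> x \<le> s then (\<lambda>j m. \<Gamma> (q j) (p m)) (k x) (i x) (\<rho> x / s) else p (i x))"
  proof (rule continuous_on_interpolation)
    show "closed X" "continuous_on X \<rho>" by fact+
    show "finite (k ` ?J)" using labelling_finite[OF k] image_mono[OF JN] by (rule finite_subset[rotated])
    show "closed ({x\<in>X. \<rho> x = 0} \<union> {x\<in>X. i x = m})" for m
    proof -
      have "{x\<in>X. \<rho> x = 0} \<union> {x\<in>X. i x = m} = X \<inter> (B \<union> {x\<in>X. i x = m})"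
        using \<rho>(3) by auto
      then show ?thesis using closed_Int[OF closedX i(2)] by simp
    qed
    show "closed {x\<in>X. \<rho> x \<le> s \<and> k x = j}" for j
      unfolding closed_sequential_limits
    proof safe
      fix x l assume x: "\<forall>n. x n \<in> {x\<in>X. \<rho> x \<le> s \<and> k x = j}" and l: "x \<longlonglongrightarrow> l"
      have "closed ?J" using continuous_on_closed_Collect_le[OF cont\<rho> continuous_on_const closedX] .
      moreover have "\<And>n. x n \<in> ?J" using x by simp
      ultimately have lJ: "l \<in> ?J" using l closed_sequentially by metis
      obtain n where "dist (x n) l < r0"
        using tendstoD[OF l labelling_pos[OF k]] by (auto simp: eventually_sequentially)
      then have "k (x n) = k l" using labelling_same[OF k] JN lJ \<open>x n \<in> ?J\<close> by blast
      with x lJ show "l \<in> X" "\<rho> l \<le> s" "k l = j" by auto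
    qed
    show "\<Gamma> (q (k x)) (p (i x)) 1 = p (i x)" if "x \<in> X" "\<rho> x \<le> s" for x
    proof (rule \<Gamma>(3))
      show "dist (q (k x)) (p (i x)) < \<delta>1"
        using q(2)[of x] p(2)[of x] that dist_triangle3[of "q (k x)" "p (i x)" "f x"] by auto
    qed (use that p q in auto)
    fix j m assume j: "j \<in> k ` ?J" "m \<in> i ` X"
    then show "continuous_on {0..1} (\<Gamma> (q j) (p m))" using \<Gamma>(1) p(1) q(1) by auto
    show "\<Gamma> (q j) (p m) 0 = \<Gamma> (q j) (p m') 0" if "m' \<in> i ` X" for m'
      using j that \<Gamma>(2) p(1) q(1) by auto
  qed (use s i \<rho> in auto)
  then have "continuous_on X g" unfolding g_def .
  moreover have "g \<in> X \<rightarrow> X"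
  proof
    fix x assume "x \<in> X"
    with \<Gamma>(4)[of "q (k x)" "p (i x)"] unit[of x] p(1) q(1) show "g x \<in> X" by (auto simp: g_def Pi_iff)
  qed
  moreover have "dist (f x) (g x) < \<epsilon>" if "x \<in> X" for x
  proof (cases "\<rho> x \<le> s")
    case True
    then have "dist (q (k x)) (g x) < \<epsilon>/3"
      unfolding g_def using \<Gamma>(5)[OF _ _ unit] p(1) q(1) that by auto
    then show ?thesis
      using q(2)[of x] True that \<delta>1 dist_triangle[of "f x" "g x" "q (k x)"] by auto
  next
    case False
    with p(2)[OF that] \<delta>1 show ?thesis by (auto simp: g_def)
  qed
  moreover have "labelling (eps_CR X g s) k r0 \<delta>"
  proof (rule labelling_subset[OF labelling_weaken[OF k]])
    show "eps_CR X g s \<subseteq> ?N"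
      unfolding eps_CR_def
    proof safe
      fix x n c assume c: "eps_chain X g s x x n c"
      then have xX: "x \<in> X" by (auto simp: eps_chain_def)
      show "\<exists>c\<in>B \<union> P. dist c x < r0"
      proof (cases "\<rho> x \<le> s")
        case True
        with xX JN show ?thesis by auto
      next
        case False
        have "\<exists>q\<in>P. dist q x < s"
        proof (rule trapped_chain[where \<rho> = \<rho> and s = s, OF c])
          show "\<not> \<rho> x \<le> s" by fact
          show "g y \<in> P" if "y \<in> X" "\<not> \<rho> y \<le> s" for y using that by (auto simp: g_def P_def)
          show "\<not> \<rho> y \<le> s" if "y \<in> X" "q \<in> P" "dist q y < s" for y q
          proof
            assume "\<rho> y \<le> s"
            then have "\<rho> q < 2 * s" using \<rho>(4)[of q y] that(3) by simp
            then obtain b where "b \<in> B" "dist b q < 2 * s" using \<rho>(5)[OF _ order_refl] by blast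
            with r1(2)[OF that(2)] s(3) show False by force
          qed
        qed
        with s show ?thesis by force
      qed
    qed
  qed simp
  ultimately show ?thesis using that s(1) by blast
qed

section \<open>Genericity\<close>

text \<open>
  A limit point \<open>l\<close> of an orbit is chain recurrent: follow the orbit from one visit near \<open>l\<close> to a later
  one, with both ends of the orbit segment replaced by \<open>l\<close>.
\<close>

lemma CR_nonempty:
  fixes X :: "'a::metric_space set"
  assumes "compact X" "X \<noteq> {}" "continuous_on X f" "f \<in> X \<rightarrow> X"
  shows "CR X f \<noteq> {}"
proof -
  obtain x0 where "x0 \<in> X" using assms(2) by blast
  define a where "a n = (f ^^ n) x0" for n
  have a_in: "a n \<in> X" for n
    by (induction n) (use \<open>x0 \<in> X\<close> assms(4) in \<open>auto simp: a_def\<close>)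
  have a_Suc: "f (a n) = a (Suc n)" for n by (simp add: a_def)
  obtain l r where l: "l \<in> X" "strict_mono r" "(a \<circ> r) \<longlonglongrightarrow> l"
    using assms(1) a_in unfolding compact_eq_seq_compact_metric seq_compact_def by metis
  have "\<exists>n c. eps_chain X f \<epsilon> l l n c" if "\<epsilon> > 0" for \<epsilon>
  proof -
    obtain d where d: "d > 0" "\<And>y. y \<in> X \<Longrightarrow> dist y l < d \<Longrightarrow> dist (f y) (f l) < \<epsilon>"
      using assms(3) l(1) \<open>\<epsilon> > 0\<close> unfolding continuous_on_iff by blast
    have "min d \<epsilon> > 0" using d(1) \<open>\<epsilon> > 0\<close> by simp
    from tendstoD[OF l(3) this] obtain N where N: "\<And>n. n \<ge> N \<Longrightarrow> dist (a (r n)) l < min d \<epsilon>"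
      by (auto simp: eventually_sequentially)
    define p where "p = r N"
    \<comment> \<open>Two visits later, so that the chain has at least two steps and no step has to absorb the
        errors of both ends.\<close>
    define n where "n = r (Suc (Suc N)) - p"
    have "r N < r (Suc N)" "r (Suc N) < r (Suc (Suc N))" using l(2) by (auto simp: strict_mono_def)
    then have n: "n \<ge> 2" "p + n = r (Suc (Suc N))" by (auto simp: n_def p_def)
    define c where "c i = (if i = 0 \<or> i = n then l else a (p + i))" for i
    have first: "dist (f l) (a (Suc p)) < \<epsilon>"
      using d(2)[OF a_in, of p] N[of N] by (simp add: a_Suc p_def dist_commute)
    have last: "dist (a (p + n)) l < \<epsilon>" using N[of "Suc (Suc N)"] n(2) by simp
    have "dist (f (c (i - 1))) (c i) < \<epsilon>" if i: "i \<in> {1..n}" for i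
    proof -
      obtain j where j: "i = Suc j" using i by (cases i) auto
      have jn: "j < n" using i j by simp
      consider "j = 0" | "j > 0" "i = n" | "j > 0" "i < n" using i by fastforce
      then show ?thesis
      proof cases
        case 1
        with first n(1) j show ?thesis by (simp add: c_def)
      next
        case 2
        with last n(1) j show ?thesis by (auto simp: c_def a_Suc)
      next
        case 3
        with \<open>\<epsilon> > 0\<close> jn show ?thesis by (simp add: c_def a_Suc j)
      qed
    qed
    then have "eps_chain X f \<epsilon> l l n c"
      using n(1) l(1) a_in by (auto simp: eps_chain_def c_def)
    then show ?thesis by blast
  qed
  with l(1) have "l \<in> CR X f" by (simp add: CR_def chain_recurrent_def)
  then show ?thesis by blast
qed

lemma eps_chain_perturb:
  assumes "eps_chain X g e x y n c" "\<And>x. x \<in> X \<Longrightarrow> dist (f x) (g x) < e'"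
  shows "eps_chain X f (e' + e) x y n c"
proof -
  have "dist (f (c (i - 1))) (c i) < e' + e" if "i \<in> {1..n}" for i
  proof -
    have "c (i - 1) \<in> X" "dist (g (c (i - 1))) (c i) < e"
      using assms(1) that by (auto simp: eps_chain_def)
    with assms(2) dist_triangle[of "f (c (i - 1))" "c i" "g (c (i - 1))"] show ?thesis by force
  qed
  with assms(1) show ?thesis by (auto simp: eps_chain_def)
qed

lemma self_maps_dist_less:
  assumes "compact X" "f \<in> mspace (self_maps X)" "g \<in> mspace (self_maps X)"
    "mdist (self_maps X) f g < r" "x \<in> X"
  shows "dist (f x) (g x) < r"
  using cfunspace_mdist_lt[of "top_of_set X" f "submetric euclidean_metric X" g r x] assms
  by (simp add: self_maps_def compactin_subtopology)

lemma self_maps_dist_le: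
  assumes "B \<ge> 0" "\<And>x. x \<in> X \<Longrightarrow> dist (f x) (g x) \<le> B"
  shows "mdist (self_maps X) f g \<le> B"
  using mdist_cfunspace_le[of B "top_of_set X" "submetric euclidean_metric X" f g] assms
  by (simp add: self_maps_def)

lemma mcomplete_self_maps:
  fixes X :: "'a::metric_space set"
  assumes "compact X"
  shows "mcomplete_of (self_maps X)"
proof -
  interpret M: Metric_space X dist by (metis Met_TC.subspace subset_UNIV)
  have Self: "submetric euclidean_metric X = M.Self"
    by (simp add: submetric_def M.Self_def)
  have "M.mtopology = top_of_set X"
    using mtopology_submetric_euclidean[of X] by (simp add: Self mtopology_of_def)
  then have "compact_space M.mtopology" using assms by (simp add: compact_space_subtopology)
  then have "M.mcomplete" by (rule M.compact_space_imp_mcomplete)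
  then show ?thesis unfolding self_maps_def Self by (rule M.mcomplete_cfunspace)
qed

text \<open>
  A labelling of \<open>eps_CR X f e\<close> for some \<open>e > 0\<close>, rather than of \<open>CR X f\<close>, leaves room for perturbing
  \<open>f\<close>: the condition is open.
\<close>

definition fine_maps :: "'a::metric_space set \<Rightarrow> real \<Rightarrow> ('a \<Rightarrow> 'a) set"
  where "fine_maps X \<delta> = {f \<in> mspace (self_maps X).
    \<exists>e>0. \<exists>k \<eta>. labelling (eps_CR X f e) k \<eta> \<delta>}"

lemma openin_fine_maps:
  assumes "compact X"
  shows "openin (mtopology_of (self_maps X)) (fine_maps X \<delta>)"
proof -
  interpret M: Metric_space "mspace (self_maps X)" "mdist (self_maps X)" by simp
  have "\<exists>r>0. M.mball f r \<subseteq> fine_maps X \<delta>" if f: "f \<in> fine_maps X \<delta>" for f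
  proof -
    obtain e k \<eta> where e: "e > 0" "labelling (eps_CR X f e) k \<eta> \<delta>"
      and fM: "f \<in> mspace (self_maps X)"
      using f by (auto simp: fine_maps_def)
    have "M.mball f (e/2) \<subseteq> fine_maps X \<delta>"
    proof
      fix g assume "g \<in> M.mball f (e/2)"
      then have g: "g \<in> mspace (self_maps X)" "mdist (self_maps X) f g < e/2" by auto
      have "eps_chain X f e x y n c" if "eps_chain X g (e/2) x y n c" for x y n c
        using eps_chain_perturb[OF that, of f "e/2"] self_maps_dist_less[OF assms fM g] by simp
      then have "eps_CR X g (e/2) \<subseteq> eps_CR X f e" unfolding eps_CR_def by blast
      then have "labelling (eps_CR X g (e/2)) k \<eta> \<delta>"
        by (rule labelling_subset[OF e(2)])
      with e(1) g(1) show "g \<in> fine_maps X \<delta>"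
        unfolding fine_maps_def using half_gt_zero by blast
    qed
    with e(1) show ?thesis by (intro exI[of _ "e/2"]) simp
  qed
  moreover have "fine_maps X \<delta> \<subseteq> mspace (self_maps X)" by (auto simp: fine_maps_def)
  ultimately show ?thesis by (simp add: mtopology_of_def M.openin_mtopology)
qed

lemma dense_fine_maps:
  fixes X :: "'a::metric_space set"
  assumes "compact X" "locally connected X" "top_of_set X dim_le 1" "\<delta> > 0"
  shows "mtopology_of (self_maps X) closure_of fine_maps X \<delta> = mspace (self_maps X)"
proof -
  interpret M: Metric_space "mspace (self_maps X)" "mdist (self_maps X)" by simp
  have "\<exists>g\<in>fine_maps X \<delta>. g \<in> M.mball f r" if f: "f \<in> mspace (self_maps X)" "r > 0" for f r
  proof -
    have fX: "continuous_on X f" "f \<in> X \<rightarrow> X" using f(1) mspace_self_maps[OF assms(1)] by auto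
    have "r/2 > 0" using f(2) by simp
    obtain g e k \<eta> where g: "continuous_on X g" "g \<in> X \<rightarrow> X"
      "\<And>x. x \<in> X \<Longrightarrow> dist (f x) (g x) < r/2"
      and e: "e > 0" "labelling (eps_CR X g e) k \<eta> \<delta>"
      by (rule chain_recurrence_perturbation[OF assms(1-3) fX \<open>r/2 > 0\<close> assms(4)]) blast
    define g' where "g' = restrict g X"
    have "eps_chain X g' e x y n c \<longleftrightarrow> eps_chain X g e x y n c" for x y n c
    proof -
      have "g' (c (i - 1)) = g (c (i - 1))" if "\<forall>i\<le>n. c i \<in> X" "i \<in> {1..n}" for i
        using that by (auto simp: g'_def)
      then show ?thesis unfolding eps_chain_def by auto
    qed
    then have same: "eps_CR X g' e = eps_CR X g e" unfolding eps_CR_def by blast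
    have g': "g' \<in> mspace (self_maps X)"
      using g(1,2) mspace_self_maps[OF assms(1)] by (auto simp: g'_def)
    have "g' \<in> fine_maps X \<delta>"
      unfolding fine_maps_def using g' e unfolding same[symmetric] by blast
    moreover have "mdist (self_maps X) f g' \<le> r/2"
      using f(2) g(3) by (intro self_maps_dist_le) (auto simp: g'_def less_imp_le)
    ultimately show ?thesis using f g' by (intro bexI[of _ g']) auto
  qed
  moreover have "fine_maps X \<delta> \<subseteq> mspace (self_maps X)" by (auto simp: fine_maps_def)
  ultimately show ?thesis by (auto simp: mtopology_of_def M.metric_closure_of)
qed

lemma CR_zero_dimensional:
  assumes "\<And>m::nat. f \<in> fine_maps X (inverse (real (Suc m)))"
  shows "top_of_set (CR X f) dim_le 0"
proof (rule small_pieces_imp_zero_dim)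
  have "\<exists>k \<eta>. labelling (CR X f) k \<eta> \<delta>" if "\<delta> > 0" for \<delta>
  proof -
    obtain m where m: "inverse (real (Suc m)) < \<delta>"
      using reals_Archimedean[OF \<open>\<delta> > 0\<close>] by blast
    obtain e k \<eta> where e: "e > 0"
      "labelling (eps_CR X f e) k \<eta> (inverse (real (Suc m)))"
      using assms[of m] by (auto simp: fine_maps_def)
    have "CR X f \<subseteq> eps_CR X f e"
      using e(1) by (auto simp: CR_def chain_recurrent_def eps_CR_def)
    then have "labelling (CR X f) k \<eta> (inverse (real (Suc m)))"
      by (rule labelling_subset[OF e(2)])
    with m show ?thesis using labelling_weaken less_imp_le by blast
  qed
  then show "small_pieces (CR X f)" by (simp add: small_pieces_def)
qed

theorem theorem4p1:
  fixes X :: "'a::metric_space set"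
  assumes "curve X"
    and "locally connected X"
  shows "zero_CR X"
proof -
  have X: "compact X" "X \<noteq> {}" "top_of_set X dim_le 1"
    using assms(1) by (auto simp: curve_def continuum_def has_dimension_def)
  interpret M: Metric_space "mspace (self_maps X)" "mdist (self_maps X)" by simp
  let ?T = "mtopology_of (self_maps X)"
  define \<G> where "\<G> = range (\<lambda>m::nat. fine_maps X (inverse (real (Suc m))))"
  have "\<Inter>\<G> \<subseteq> {f \<in> mspace (self_maps X). has_dimension (top_of_set (CR X f)) 0}"
  proof
    fix f assume "f \<in> \<Inter>\<G>"
    then have f: "f \<in> fine_maps X (inverse (real (Suc m)))" for m by (auto simp: \<G>_def)
    then have fM: "f \<in> mspace (self_maps X)" by (auto simp: fine_maps_def)
    then have "CR X f \<noteq> {}"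
      using CR_nonempty[OF X(1,2)] mspace_self_maps[OF X(1)] by auto
    moreover have "top_of_set (CR X f) dim_le 0" using f by (rule CR_zero_dimensional)
    moreover have "top_of_set (CR X f) \<noteq> trivial_topology"
      using \<open>CR X f \<noteq> {}\<close> by (metis topspace_euclidean_subtopology topspace_discrete_topology)
    ultimately show "f \<in> {f \<in> mspace (self_maps X). has_dimension (top_of_set (CR X f)) 0}"
      using fM by (simp add: has_dimension_def)
  qed
  moreover have "gdelta_in ?T (\<Inter>\<G>)"
    by (rule gdelta_in_Inter)
      (auto simp: \<G>_def intro: open_imp_gdelta_in openin_fine_maps[OF X(1)])
  moreover have "?T closure_of \<Inter>\<G> = topspace ?T"
  proof -
    have "M.mtopology closure_of \<Inter>\<G> = mspace (self_maps X)"
    proof (rule M.metric_Baire_category)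
      show "M.mcomplete" using mcomplete_self_maps[OF X(1)] by (simp add: mcomplete_of_def)
      show "countable \<G>" by (simp add: \<G>_def)
      show "openin M.mtopology T \<and> M.mtopology closure_of T = mspace (self_maps X)" if "T \<in> \<G>" for T
        using that openin_fine_maps[OF X(1)] dense_fine_maps[OF X(1) assms(2) X(3)]
        by (auto simp: \<G>_def mtopology_of_def)
    qed
    then show ?thesis by (simp add: mtopology_of_def)
  qed
  ultimately have "residual_in ?T {f \<in> mspace (self_maps X). has_dimension (top_of_set (CR X f)) 0}"
    unfolding residual_in_def by auto
  then show ?thesis using X(1) by (simp add: zero_CR_def generic_self_map_def)
qed

end
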